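(* Let $a\ge 2$ be an integer. There exists a constant $C$, independent of $n$, such that for every integer $n\ge 2$, if $\rho_{n,a}$ is a random permutation in $S_n$ with the unbiased $a$-shuffle distribution $P_{n,a}$, then $$d_K\left(\frac{\mathrm{des}(\rho_{n,a})-\frac{(a-1)(n-1)}{2a}}{\sqrt{\frac{(a^2-1)(n-1)}{12a^2}}},\; Z\right)\le \frac{C}{\sqrt{n}},$$ where $Z$ is a standard normal random variable.
   Context: For $\pi\in S_n$, $\mathrm{des}(\pi)=\#\{1\le i\le n-1:\ \pi(i)>\pi(i+1)\}$ is the number of descents. Riffle shuffle distribution: let $\mathbf{p}=(p_1,\dots,p_a)$ be a probability vector. Starting with a deck of $n$ cards labelled $1,\dots,n$ from top to bottom, cut it into $a$ consecutive piles of sizes $b_1,\dots,b_a$ ($b_i\ge 0$, $\sum b_i=n$; the first pile consists of the top $b_1$ cards, the second of the next $b_2$ cards, and so on), where $(b_1,\dots,b_a)$ is chosen with probability $\binom{n}{b_1,\dots,b_a}\prod_{i=1}^a p_i^{b_i}$. Then choose uniformly one of the $\binom{n}{b_1,\dots,b_a}$ ways of interleaving the piles, keeping the cards of each pile in their original relative order. Let $\rho(i)$ be the label of the card in position $i$ after the shuffle. The law of the permutation $\rho\in S_n$ is denoted $P_{n,a,\mathbf{p}}$; when $\mathbf{p}=(1/a,\dots,1/a)$ the shuffle is called unbiased and the law is denoted $P_{n,a}$. The Kolmogorov distance between two real random variables (i.e. between their laws) is $d_K(X,Y)=\sup_{z\in\mathbb{R}}|\mathbb{P}(X\le z)-\mathbb{P}(Y\le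 z)|$. *)

theory Defs
  imports "HOL-Probability.Probability" "HOL-Combinatorics.Permutations"
begin

text \<open>Elements of \<open>S\<^sub>n\<close> are the functions \<open>\<pi>\<close> with \<open>\<pi> permutes {1..n}\<close>.\<close>

definition des :: "nat \<Rightarrow> (nat \<Rightarrow> nat) \<Rightarrow> nat"
  where "des n \<pi> = card {i \<in> {1..n - 1}. \<pi> i > \<pi> (i + 1)}"

definition pile_sizes :: "nat \<Rightarrow> nat \<Rightarrow> (nat \<Rightarrow> nat) set"
  where "pile_sizes n a = {b \<in> {1..a} \<rightarrow>\<^sub>E UNIV. (\<Sum>i\<in>{1..a}. b i) = n}"

definition cut_density :: "nat \<Rightarrow> nat \<Rightarrow> (nat \<Rightarrow> real) \<Rightarrow> (nat \<Rightarrow> nat) \<Rightarrow> real"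
  where "cut_density n a p b =
    (if b \<in> pile_sizes n a
     then fact n / (\<Prod>i\<in>{1..a}. fact (b i)) * (\<Prod>i\<in>{1..a}. p i ^ b i) else 0)"

text \<open>
  Meaningful only if \<open>p\<close> is a probability vector on \<open>{1..a}\<close>;
  see \<open>pmf_cut_pmf\<close> below.
\<close>
definition cut_pmf :: "nat \<Rightarrow> nat \<Rightarrow> (nat \<Rightarrow> real) \<Rightarrow> (nat \<Rightarrow> nat) pmf"
  where "cut_pmf n a p = embed_pmf (cut_density n a p)"

definition pile :: "(nat \<Rightarrow> nat) \<Rightarrow> nat \<Rightarrow> nat set"
  where "pile b i = {(\<Sum>j\<in>{1..<i}. b j) + 1 .. \<Sum>j\<in>{1..i}. b j}"

text \<open>
  As \<open>\<rho> k\<close> is the label of the card in position \<open>k\<close>, the card labelled \<open>c\<close> ends up in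
  position \<open>inv \<rho> c\<close>. The piles keep their internal order iff these positions increase
  along each pile. Since cards are labelled, distinct interleavings are distinct \<open>\<rho>\<close>.
\<close>
definition interleavings :: "nat \<Rightarrow> nat \<Rightarrow> (nat \<Rightarrow> nat) \<Rightarrow> (nat \<Rightarrow> nat) set"
  where "interleavings n a b =
    {\<rho>. \<rho> permutes {1..n} \<and> (\<forall>i\<in>{1..a}. strict_mono_on (pile b i) (inv \<rho>))}"

definition riffle_pmf :: "nat \<Rightarrow> nat \<Rightarrow> (nat \<Rightarrow> real) \<Rightarrow> (nat \<Rightarrow> nat) pmf"
  where "riffle_pmf n a p =
    bind_pmf (cut_pmf n a p) (\<lambda>b. pmf_of_set (interleavings n a b))"

definition unbiased_riffle_pmf :: "nat \<Rightarrow> nat \<Rightarrow> (nat \<Rightarrow> nat) pmf"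
  where "unbiased_riffle_pmf n a = riffle_pmf n a (\<lambda>_. 1 / real a)"

text \<open>The distance between the laws \<open>M\<close> and \<open>N\<close> of two real random variables.\<close>
definition kolmogorov_dist :: "real measure \<Rightarrow> real measure \<Rightarrow> real"
  where "kolmogorov_dist M N = (SUP z. \<bar>cdf M z - cdf N z\<bar>)"


subsection \<open>Well-definedness of the riffle shuffle distribution\<close>

lemma finite_interleavings: "finite (interleavings n a b)"
  unfolding interleavings_def
  by (rule finite_subset[OF _ finite_permutations[of "{1..n}"]]) auto

lemma interleavings_nonempty: "interleavings n a b \<noteq> {}"
proof -
  have "id \<in> interleavings n a b"
    by (auto simp: interleavings_def permutes_id strict_mono_on_def)
  thus ?thesis by blast
qed

lemma finite_compositions:
  assumes "finite A"
  shows "finite {b \<in> A \<rightarrow>\<^sub>E (UNIV :: nat set). sum b A = n}"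
proof (rule finite_subset)
  show "{b \<in> A \<rightarrow>\<^sub>E (UNIV :: nat set). sum b A = n} \<subseteq> A \<rightarrow>\<^sub>E {..n}"
    using assms by (auto intro!: member_le_sum dest: PiE_arb)
  show "finite (A \<rightarrow>\<^sub>E {..n})" using assms by (intro finite_PiE) auto
qed

lemma multinomial_sum:
  fixes p :: "'i \<Rightarrow> real"
  assumes "finite A"
  shows "(\<Sum>b | b \<in> A \<rightarrow>\<^sub>E (UNIV :: nat set) \<and> sum b A = n. \<Prod>i\<in>A. p i ^ b i / fact (b i))
         = sum p A ^ n / fact n"
  using assms
proof (induction A arbitrary: n rule: finite_induct)
  case empty
  have "{b \<in> {} \<rightarrow>\<^sub>E (UNIV :: nat set). sum b {} = n}
        = (if n = 0 then {\<lambda>_. undefined} else {})"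
    by auto
  thus ?case by (cases "n = 0") auto
next
  case (insert x A)
  let ?B = "\<lambda>A n. {b \<in> A \<rightarrow>\<^sub>E (UNIV :: nat set). sum b A = n}"
  let ?g = "\<lambda>(k, b). b(x := k)"
  let ?S = "Sigma {..n} (\<lambda>k. ?B A (n - k))"
  let ?f = "\<lambda>b. \<Prod>i\<in>insert x A. p i ^ b i / fact (b i)"
  have upd: "(\<Sum>i\<in>A. if i = x then k else b i) = sum b A" for b :: "'i \<Rightarrow> nat" and k
    using insert.hyps by (intro sum.cong) auto
  have bij: "bij_betw ?g ?S (?B (insert x A) n)"
  proof (rule bij_betwI[where g = "\<lambda>b. (b x, b(x := undefined))"])
    show "?g \<in> ?S \<rightarrow> ?B (insert x A) n"
      using insert.hyps by (auto simp: PiE_iff upd extensional_def)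
    show "(\<lambda>b. (b x, b(x := undefined))) \<in> ?B (insert x A) n \<rightarrow> ?S"
      using insert.hyps by (auto simp: PiE_iff upd extensional_def)
    show "(\<lambda>b. (b x, b(x := undefined))) (?g y) = y" if "y \<in> ?S" for y
      using that insert.hyps by (auto simp: PiE_iff extensional_def fun_eq_iff)
    show "?g ((\<lambda>b. (b x, b(x := undefined))) b) = b" for b by auto
  qed
  have eq: "?f (b(x := k)) = p x ^ k / fact k * (\<Prod>i\<in>A. p i ^ b i / fact (b i))" for b k
  proof -
    have "(\<Prod>i\<in>A. p i ^ (b(x := k)) i / fact ((b(x := k)) i))
          = (\<Prod>i\<in>A. p i ^ b i / fact (b i))"
      using insert.hyps by (intro prod.cong) auto
    thus ?thesis using insert.hyps by simp
  qed
  have "sum ?f (?B (insert x A) n) = (\<Sum>y\<in>?S. ?f (?g y))"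
    using sum.reindex_bij_betw[OF bij, of ?f] by simp
  also have "\<dots> = (\<Sum>k\<le>n. \<Sum>b\<in>?B A (n - k). ?f (b(x := k)))"
    by (subst sum.Sigma) (auto intro: finite_compositions insert.hyps simp: split_def)
  also have "\<dots> = (\<Sum>k\<le>n. p x ^ k / fact k * (sum p A ^ (n - k) / fact (n - k)))"
    by (simp only: eq sum_distrib_left[symmetric] insert.IH)
  also have "\<dots> = (\<Sum>k\<le>n. real (n choose k) * p x ^ k * sum p A ^ (n - k)) / fact n"
    by (simp add: sum_divide_distrib binomial_fact field_simps)
  also have "\<dots> = sum p (insert x A) ^ n / fact n"
    using insert.hyps by (simp add: binomial_ring)
  finally show ?case by simp
qed

lemma pmf_cut_pmf:
  assumes "\<And>i. i \<in> {1..a} \<Longrightarrow> p i \<ge> 0" and "(\<Sum>i\<in>{1..a}. p i) = 1"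
  shows "pmf (cut_pmf n a p) b = cut_density n a p b"
  unfolding cut_pmf_def
proof (rule pmf_embed_pmf)
  show nonneg: "0 \<le> cut_density n a p b" for b
    using assms(1)
    by (auto simp: cut_density_def intro!: mult_nonneg_nonneg divide_nonneg_nonneg prod_nonneg)
  have fin: "finite (pile_sizes n a)"
    unfolding pile_sizes_def by (rule finite_compositions) simp
  have "(\<integral>\<^sup>+b. ennreal (cut_density n a p b) \<partial>count_space UNIV)
        = (\<Sum>b\<in>pile_sizes n a. ennreal (cut_density n a p b))"
    by (rule nn_integral_count_space'[OF fin]) (auto simp: cut_density_def)
  also have "\<dots> = ennreal (\<Sum>b\<in>pile_sizes n a. cut_density n a p b)"
    using nonneg by simp
  also have "(\<Sum>b\<in>pile_sizes n a. cut_density n a p b)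
        = (\<Sum>b\<in>pile_sizes n a. fact n * (\<Prod>i\<in>{1..a}. p i ^ b i / fact (b i)))"
    by (intro sum.cong) (auto simp: cut_density_def prod_dividef)
  also have "\<dots> = fact n * ((\<Sum>i\<in>{1..a}. p i) ^ n / fact n)"
    by (simp only: sum_distrib_left[symmetric] pile_sizes_def multinomial_sum finite_atLeastAtMost)
  also have "\<dots> = 1" by (simp only: assms(2)) simp
  finally show "(\<integral>\<^sup>+b. ennreal (cut_density n a p b) \<partial>count_space UNIV) = 1" by simp
qed

end

theory Submission
  imports Defs "HOL-Combinatorics.Multiset_Permutations"
begin

text \<open>
  The descents of a shuffled deck are turned into a sum of independent bounded variables, for which
  a Berry--Esseen bound is proved by Stein's method.

  Write down, for every position of the shuffled deck, the pile from which its card came. For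
  independent pile labels this is a word of independent letters, and interleavings of given piles
  correspond to words with given letter multiplicities. Since a pile keeps its order, the descents of
  the permutation are the strict descents of the word (\<open>des_riffle_pmf\<close>).

  For a word \<open>x\<^sub>1 \<dots> x\<^sub>n\<close> over \<open>{1..a}\<close> consider the cyclic differences, that is, the representatives
  of \<open>x\<^sub>k\<^sub>+\<^sub>1 - x\<^sub>k\<close> modulo \<open>a\<close> in \<open>{0..<a}\<close>. They exceed the ordinary differences by \<open>a\<close> at each
  descent, so their sum is \<open>a\<close> times the number of descents plus \<open>x\<^sub>n - x\<^sub>1\<close>
  (\<open>cyclic_variation_eq\<close>). If the letters are independent and uniform, then so are the \<open>n - 1\<close> cyclic
  differences (\<open>cyclic_variation_law\<close>). The uniform law on \<open>{0..<a}\<close> has mean \<open>(a - 1) / 2\<close> and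
  variance \<open>(a\<^sup>2 - 1) / 12\<close>; hence the standardisation in the theorem is that of this sum, up to the
  boundary term \<open>x\<^sub>n - x\<^sub>1\<close>, which is bounded by \<open>a - 1\<close>.

  It remains to prove a Berry--Esseen bound for a sum of independent variables with values in
  \<open>{0..m}\<close>. Let \<open>W\<close> be the standardised sum, \<open>h\<close> the standardised length \<open>m\<close>, and \<open>f\<close> the
  bounded solution of \<open>f' x = x * f x + of_bool (x \<le> z) - \<Phi> z\<close>. Summation by parts in one summand
  writes \<open>E (W f(W))\<close> as an average of difference quotients of \<open>f\<close> over lattice cells within \<open>h\<close>
  of \<open>W\<close>, so as \<open>E (f' W\<^sup>*)\<close> for a variable \<open>W\<^sup>*\<close> within \<open>h\<close> of \<open>W\<close> (the zero-bias coupling).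
  Applying the equation at \<open>W\<^sup>*\<close> and not at \<open>W\<close> is what avoids any smoothing: the quantity
  \<open>P (W\<^sup>* \<le> z) - \<Phi> z\<close> equals \<open>E (W f(W)) - E (W\<^sup>* f(W\<^sup>*))\<close>, which is small because \<open>x * f x\<close> is
  locally Lipschitz, and \<open>P (W\<^sup>* \<le> z)\<close> lies between \<open>P (W \<le> z - h)\<close> and \<open>P (W \<le> z + h)\<close>
  (\<open>berry_esseen_lower_upper\<close>). Since \<open>h\<close> is of order \<open>1 / sqrt n\<close> and \<open>\<Phi>\<close> is Lipschitz, the
  theorem follows.
\<close>

section \<open>The normal distribution and its Stein equation\<close>

text \<open>
  A constant of its own keeps the simplifier from rewriting the density inside the measure.
\<close>
definition std_normal_cdf :: "real \<Rightarrow> real" ("\<Phi>")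
  where "\<Phi> x = cdf std_normal_distribution x"

abbreviation std_normal_pdf :: "real \<Rightarrow> real" ("\<phi>")
  where "\<phi> \<equiv> std_normal_density"

interpretation std_normal: real_distribution std_normal_distribution
  by (rule real_dist_normal_dist)

lemma std_normal_cdf_eq: "\<Phi> = cdf std_normal_distribution"
  by (simp add: std_normal_cdf_def fun_eq_iff)

lemmas std_normal_cdf_nonneg = std_normal.cdf_nonneg[folded std_normal_cdf_eq]
lemmas std_normal_cdf_le_1 = std_normal.cdf_bounded_prob[folded std_normal_cdf_eq]
lemmas std_normal_cdf_mono = std_normal.cdf_nondecreasing[folded std_normal_cdf_eq]
lemmas std_normal_cdf_at_top = std_normal.cdf_lim_at_top_prob[folded std_normal_cdf_eq]
lemmas std_normal_cdf_at_bot = std_normal.cdf_lim_at_bot[folded std_normal_cdf_eq]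

lemma std_normal_cdf_diff:
  assumes "x \<le> y"
  shows "\<Phi> y - \<Phi> x = integral {x..y} \<phi>"
proof (cases "x = y")
  case False
  have int: "set_integrable lborel {x<..y} \<phi>"
    unfolding set_integrable_def
    by (intro integrable_mult_indicator integrable_normal_moment[of _ _ 0, simplified]) auto
  have "ennreal (measure std_normal_distribution {x<..y}) = emeasure std_normal_distribution {x<..y}"
    by (simp add: std_normal.emeasure_eq_measure)
  also have "\<dots> = (\<integral>\<^sup>+t. ennreal (\<phi> t) * indicator {x<..y} t \<partial>lborel)"
    by (subst emeasure_density) auto
  also have "\<dots> = (\<integral>\<^sup>+t. ennreal (indicator {x<..y} t * \<phi> t) \<partial>lborel)"
    by (intro nn_integral_cong) (auto split: split_indicator)
  also have "\<dots> = ennreal (LINT t|lborel. indicator {x<..y} t * \<phi> t)"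
    using int by (intro nn_integral_eq_integral) (auto simp: set_integrable_def)
  finally have "measure std_normal_distribution {x<..y} = (LINT t|lborel. indicator {x<..y} t * \<phi> t)"
    by (subst (asm) ennreal_inj) (auto intro!: integral_nonneg_AE)
  also have "\<dots> = integral {x<..y} \<phi>"
    using set_borel_integral_eq_integral(2)[OF int] by (simp add: set_lebesgue_integral_def)
  also have "\<dots> = integral {x..y} \<phi>"
    by (rule integral_subset_negligible[symmetric, of "{x<..y}" "{x..y}", symmetric])
       (auto intro: negligible_subset[of "{x}"])
  finally show ?thesis using False assms std_normal.cdf_diff_eq[of x y, folded std_normal_cdf_eq] by simp
qed simp

lemma DERIV_std_normal_cdf: "(\<Phi> has_real_derivative \<phi> x) (at x)"
proof -
  have cont: "continuous_on {x - 1..x + 1} \<phi>"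
    unfolding std_normal_density_def by (intro continuous_intros) auto
  have "((\<lambda>u. integral {x - 1..u} \<phi>) has_real_derivative \<phi> x) (at x within {x - 1..x + 1})"
    by (rule integral_has_real_derivative[OF cont]) auto
  hence "((\<lambda>u. integral {x - 1..u} \<phi> + \<Phi> (x - 1)) has_real_derivative \<phi> x) (at x)"
    by (auto intro!: derivative_eq_intros simp: at_within_Icc_at)
  thus ?thesis
  proof (rule DERIV_cong_ev[OF refl _ refl, THEN iffD1, rotated])
    show "eventually (\<lambda>u. integral {x - 1..u} \<phi> + \<Phi> (x - 1) = \<Phi> u) (nhds x)"
      using eventually_nhds_in_open[of "{x - 1<..}" x]
      by (auto elim!: eventually_mono simp flip: std_normal_cdf_diff)
  qed
qed

lemma DERIV_std_normal_pdf: "(\<phi> has_real_derivative - x * \<phi> x) (at x)"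
proof -
  have "((\<lambda>x. c * exp (- x\<^sup>2 / 2)) has_real_derivative - x * (c * exp (- x\<^sup>2 / 2))) (at x)" for c
    by (auto intro!: derivative_eq_intros)
  thus ?thesis unfolding std_normal_density_def .
qed

lemmas std_normal_derivs =
  DERIV_chain2[OF DERIV_std_normal_cdf] DERIV_chain2[OF DERIV_std_normal_pdf]

lemma std_normal_pdf_pos: "\<phi> x > 0"
  by (simp add: normal_density_pos)

lemma std_normal_pdf_le_1: "\<phi> x \<le> 1"
proof -
  have "exp (- x\<^sup>2 / 2) \<le> 1" by simp
  also have "1 \<le> sqrt (2 * pi)" using pi_gt3 by simp
  finally show ?thesis unfolding std_normal_density_def by (simp add: divide_simps)
qed

lemma std_normal_cdf_lipschitz:
  assumes "x \<le> y"
  shows "\<Phi> y \<le> \<Phi> x + (y - x)"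
proof -
  have "(\<lambda>t. \<Phi> t - t) y \<le> (\<lambda>t. \<Phi> t - t) x"
  proof (rule DERIV_nonpos_imp_nonincreasing[OF assms])
    fix t
    have "((\<lambda>t. \<Phi> t - t) has_real_derivative \<phi> t - 1) (at t)"
      by (auto intro!: derivative_eq_intros std_normal_derivs)
    thus "\<exists>d. ((\<lambda>t. \<Phi> t - t) has_real_derivative d) (at t) \<and> d \<le> 0"
      using std_normal_pdf_le_1[of t] by auto
  qed
  thus ?thesis by simp
qed

lemma std_normal_cdf_symmetric: "\<Phi> (- x) = 1 - \<Phi> x"
proof -
  have "((\<lambda>t. \<Phi> t + \<Phi> (- t)) has_real_derivative 0) (at t)" for t
    by (auto intro!: derivative_eq_intros std_normal_derivs simp: std_normal_density_def)
  hence const: "\<Phi> t + \<Phi> (- t) = \<Phi> x + \<Phi> (- x)" for t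
    by (intro DERIV_isconst_all) auto
  have "((\<lambda>t. \<Phi> t + \<Phi> (- t)) \<longlongrightarrow> 1 + 0) at_top"
    by (intro tendsto_add std_normal_cdf_at_top
              filterlim_compose[OF std_normal_cdf_at_bot filterlim_uminus_at_bot_at_top])
  hence "((\<lambda>t. \<Phi> x + \<Phi> (- x)) \<longlongrightarrow> 1 + 0) (at_top :: real filter)"
    by (subst (asm) const)
  hence "\<Phi> x + \<Phi> (- x) = 1" by (simp add: tendsto_const_iff)
  thus ?thesis by simp
qed

text \<open>
  \<open>1 - \<Phi> x - \<phi> x / x\<close> tends to 0 at infinity, and it increases on \<open>x > 0\<close>, because its
  derivative is \<open>\<phi> x / x\<^sup>2\<close>. Hence it is nowhere positive there.
\<close>
lemma mills_ratio_upper: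
  assumes "x > 0"
  shows "x * (1 - \<Phi> x) \<le> \<phi> x"
proof -
  let ?d = "\<lambda>t. 1 - \<Phi> t - \<phi> t / t"
  have inc: "?d x \<le> ?d y" if "x \<le> y" for y
  proof (rule DERIV_nonneg_imp_nondecreasing[OF that])
    fix t assume "x \<le> t" "t \<le> y"
    with assms have "t > 0" by simp
    hence "(?d has_real_derivative \<phi> t / t\<^sup>2) (at t)"
      by (auto intro!: derivative_eq_intros std_normal_derivs simp: field_simps power2_eq_square)
    thus "\<exists>d. (?d has_real_derivative d) (at t) \<and> 0 \<le> d"
      using std_normal_pdf_pos[of t] by (auto intro!: exI)
  qed
  have "((\<lambda>t. \<phi> t / t) \<longlongrightarrow> 0) at_top"
  proof (rule tendsto_sandwich[of "\<lambda>_. 0" _ _ "\<lambda>t::real. 1 / t"])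
    show "eventually (\<lambda>t. 0 \<le> \<phi> t / t) at_top"
      using eventually_gt_at_top[of 0]
      by eventually_elim (auto intro: less_imp_le[OF std_normal_pdf_pos])
    show "eventually (\<lambda>t. \<phi> t / t \<le> 1 / t) at_top"
      using eventually_gt_at_top[of 0]
      by eventually_elim (auto intro: divide_right_mono std_normal_pdf_le_1)
    show "((\<lambda>t::real. 1 / t) \<longlongrightarrow> 0) at_top"
      by (intro tendsto_divide_0[OF tendsto_const] filterlim_at_top_imp_at_infinity filterlim_ident)
  qed auto
  hence "(?d \<longlongrightarrow> 1 - 1 - 0) at_top"
    by (intro tendsto_intros std_normal_cdf_at_top)
  hence "?d x \<le> 1 - 1 - 0"
    by (rule tendsto_lowerbound[OF _ eventually_mono[OF eventually_ge_at_top[of x] inc]])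
       (simp_all add: trivial_limit_at_top_linorder)
  thus ?thesis using assms by (simp add: field_simps)
qed

text \<open>
  For every \<open>z\<close> the solution of Stein's equation below is at most this function of \<open>x\<close>, so that
  estimates uniform in \<open>z\<close> reduce to estimates of \<open>stein_bound\<close>.
\<close>
definition stein_bound :: "real \<Rightarrow> real"
  where "stein_bound x = \<Phi> x * (1 - \<Phi> x) / \<phi> x"

lemma stein_bound_nonneg: "0 \<le> stein_bound x"
  using std_normal_cdf_nonneg std_normal_cdf_le_1 std_normal_pdf_pos[of x]
  by (simp add: stein_bound_def)

lemma stein_bound_symmetric: "stein_bound (- x) = stein_bound x"
  by (simp add: stein_bound_def std_normal_cdf_symmetric std_normal_density_def)

lemma abs_mult_stein_bound: "\<bar>x\<bar> * stein_bound x \<le> 1"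
proof -
  have *: "x * stein_bound x \<le> 1" if "x > 0" for x
  proof -
    have "\<Phi> x * (x * (1 - \<Phi> x)) \<le> 1 * \<phi> x"
      using that std_normal_cdf_nonneg std_normal_cdf_le_1
      by (intro mult_mono mills_ratio_upper) auto
    thus ?thesis using std_normal_pdf_pos[of x] by (simp add: stein_bound_def field_simps)
  qed
  show ?thesis using *[of x] *[of "-x"] by (cases x "0::real" rule: linorder_cases)
    (simp_all add: stein_bound_symmetric)
qed

text \<open>For \<open>\<bar>x\<bar> \<ge> 1\<close> this follows from Mills' inequality, otherwise from \<open>\<phi> x \<ge> \<phi> 1\<close>.\<close>
lemma stein_bound_le: "stein_bound x \<le> 5"
proof (cases "\<bar>x\<bar> \<ge> 1")
  case True
  hence "1 * stein_bound x \<le> \<bar>x\<bar> * stein_bound x"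
    by (intro mult_right_mono stein_bound_nonneg)
  thus ?thesis using abs_mult_stein_bound[of x] by linarith
next
  case False
  have "\<Phi> x * (1 - \<Phi> x) \<le> 1"
    using std_normal_cdf_nonneg[of x] std_normal_cdf_le_1[of x]
    by (intro mult_le_one) auto
  moreover have "\<phi> x \<ge> 1 / 5"
  proof -
    have "x\<^sup>2 \<le> 1" using False by (simp add: abs_square_le_1)
    hence "exp (x\<^sup>2 / 2) \<le> exp (1 / 2)" by simp
    also have "\<dots> = sqrt (exp 1)"
      by (rule real_sqrt_unique[symmetric]) (simp_all flip: exp_double)
    finally have "sqrt (2 * pi) * exp (x\<^sup>2 / 2) \<le> sqrt (2 * pi) * sqrt (exp 1)"
      by (rule mult_left_mono) simp
    also have "\<dots> = sqrt (2 * pi * exp 1)" by (simp add: real_sqrt_mult)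
    also have "\<dots> \<le> sqrt (8 * 3)"
      using pi_less_4 exp_le by (intro real_sqrt_le_mono mult_mono) auto
    also have "\<dots> \<le> 5" by (rule real_le_lsqrt) auto
    finally have "sqrt (2 * pi) * exp (x\<^sup>2 / 2) \<le> 5" .
    moreover have "\<phi> x = 1 / (sqrt (2 * pi) * exp (x\<^sup>2 / 2))"
      by (simp add: std_normal_density_def exp_minus field_simps)
    moreover have "1 / 5 \<le> 1 / (sqrt (2 * pi) * exp (x\<^sup>2 / 2))"
      using calculation(1) by (intro divide_left_mono) auto
    ultimately show ?thesis by simp
  qed
  ultimately show ?thesis
    using std_normal_pdf_pos[of x] by (simp add: stein_bound_def field_simps)
qed

text \<open>
  Stein's equation for a half-line is \<open>f' x = x * f x + of_bool (x \<le> z) - \<Phi> z\<close>. Its bounded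
  solution is built from two smooth functions: \<open>stein_left z\<close> solves it with the indicator replaced
  by 1, \<open>stein_right z\<close> with the indicator replaced by 0, and the two agree at \<open>z\<close>. The solution
  has a kink at \<open>z\<close>, so the mean value theorem is applied to each branch separately.
\<close>
definition stein_left :: "real \<Rightarrow> real \<Rightarrow> real"
  where "stein_left z x = \<Phi> x * (1 - \<Phi> z) / \<phi> x"

definition stein_right :: "real \<Rightarrow> real \<Rightarrow> real"
  where "stein_right z x = \<Phi> z * (1 - \<Phi> x) / \<phi> x"

definition stein_solution :: "real \<Rightarrow> real \<Rightarrow> real"
  where "stein_solution z x = (if x \<le> z then stein_left z x else stein_right z x)"

lemma DERIV_stein_left:
  "(stein_left z has_real_derivative x * stein_left z x + 1 - \<Phi> z) (at x)"
  using std_normal_pdf_pos[of x] unfolding stein_left_def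
  by (auto intro!: derivative_eq_intros std_normal_derivs simp: field_simps)

lemma DERIV_stein_right:
  "(stein_right z has_real_derivative x * stein_right z x - \<Phi> z) (at x)"
  using std_normal_pdf_pos[of x] unfolding stein_right_def
  by (auto intro!: derivative_eq_intros std_normal_derivs simp: field_simps)

lemma stein_solution_left: "x \<le> z \<Longrightarrow> stein_solution z x = stein_left z x"
  by (simp add: stein_solution_def)

lemma stein_solution_right: "z \<le> x \<Longrightarrow> stein_solution z x = stein_right z x"
  by (cases "x = z") (simp_all add: stein_solution_def stein_left_def stein_right_def)

lemma stein_solution_diff_left:
  assumes "x < y" "y \<le> z"
  obtains \<xi> where "x < \<xi>" "\<xi> < y"
    "stein_solution z y - stein_solution z x = (y - x) * (\<xi> * stein_solution z \<xi> + 1 - \<Phi> z)"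
proof -
  obtain \<xi> where "x < \<xi>" "\<xi> < y"
    "stein_left z y - stein_left z x = (y - x) * (\<xi> * stein_left z \<xi> + 1 - \<Phi> z)"
    using MVT2[OF assms(1) DERIV_stein_left] by blast
  thus thesis using assms that[of \<xi>] by (simp add: stein_solution_left)
qed

lemma stein_solution_diff_right:
  assumes "x < y" "z \<le> x"
  obtains \<xi> where "x < \<xi>" "\<xi> < y"
    "stein_solution z y - stein_solution z x = (y - x) * (\<xi> * stein_solution z \<xi> - \<Phi> z)"
proof -
  obtain \<xi> where "x < \<xi>" "\<xi> < y"
    "stein_right z y - stein_right z x = (y - x) * (\<xi> * stein_right z \<xi> - \<Phi> z)"
    using MVT2[OF assms(1) DERIV_stein_right] by blast
  thus thesis using assms that[of \<xi>] by (simp add: stein_solution_right)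
qed

lemma stein_solution_bounds: "0 \<le> stein_solution z x" "stein_solution z x \<le> stein_bound x"
proof -
  have "\<Phi> x * (1 - \<Phi> z) \<le> \<Phi> x * (1 - \<Phi> x)" if "x \<le> z"
    using that by (intro mult_left_mono std_normal_cdf_nonneg) (simp add: std_normal_cdf_mono)
  moreover have "\<Phi> z * (1 - \<Phi> x) \<le> \<Phi> x * (1 - \<Phi> x)" if "z \<le> x"
    using that by (intro mult_right_mono) (simp_all add: std_normal_cdf_mono std_normal_cdf_le_1)
  ultimately show "stein_solution z x \<le> stein_bound x"
    using std_normal_pdf_pos[of x]
    by (auto simp: stein_solution_def stein_bound_def stein_left_def stein_right_def
             intro!: divide_right_mono)
  show "0 \<le> stein_solution z x"
    using std_normal_pdf_pos[of x] std_normal_cdf_nonneg std_normal_cdf_le_1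
    by (auto simp: stein_solution_def stein_left_def stein_right_def)
qed

lemma abs_stein_solution_le: "\<bar>stein_solution z x\<bar> \<le> 5"
  using stein_solution_bounds[where z = z and x = x] stein_bound_le[of x] by simp

lemma abs_mult_stein_solution_le: "\<bar>x * stein_solution z x\<bar> \<le> 1"
proof -
  have "\<bar>x\<bar> * stein_solution z x \<le> \<bar>x\<bar> * stein_bound x"
    by (intro mult_left_mono stein_solution_bounds) auto
  thus ?thesis
    using abs_mult_stein_bound[of x] stein_solution_bounds(1)[of z x] by (simp add: abs_mult)
qed

lemma stein_solution_lipschitz:
  "\<bar>stein_solution z y - stein_solution z x\<bar> \<le> 2 * \<bar>y - x\<bar>"
proof -
  let ?f = "stein_solution z"
  note \<Phi> = std_normal_cdf_nonneg[of z] std_normal_cdf_le_1[of z]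
  have left: "\<bar>?f y - ?f x\<bar> \<le> 2 * (y - x)" if "x \<le> y" "y \<le> z" for x y
  proof (cases "x = y")
    case False
    with that obtain \<xi> where
      "?f y - ?f x = (y - x) * (\<xi> * ?f \<xi> + 1 - \<Phi> z)"
      using stein_solution_diff_left[of x y z] by auto
    moreover have "\<bar>\<xi> * ?f \<xi> + 1 - \<Phi> z\<bar> \<le> 2"
      using abs_mult_stein_solution_le[of \<xi> z] \<Phi> by linarith
    ultimately have "\<bar>?f y - ?f x\<bar> \<le> \<bar>y - x\<bar> * 2"
      unfolding abs_mult by (metis abs_ge_zero abs_mult mult_left_mono)
    thus ?thesis using that by simp
  qed simp
  have right: "\<bar>?f y - ?f x\<bar> \<le> 2 * (y - x)" if "x \<le> y" "z \<le> x" for x y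
  proof (cases "x = y")
    case False
    with that obtain \<xi> where
      "?f y - ?f x = (y - x) * (\<xi> * ?f \<xi> - \<Phi> z)"
      using stein_solution_diff_right[of x y z] by auto
    moreover have "\<bar>\<xi> * ?f \<xi> - \<Phi> z\<bar> \<le> 2"
      using abs_mult_stein_solution_le[of \<xi> z] \<Phi> by linarith
    ultimately have "\<bar>?f y - ?f x\<bar> \<le> \<bar>y - x\<bar> * 2"
      unfolding abs_mult by (metis abs_ge_zero abs_mult mult_left_mono)
    thus ?thesis using that by simp
  qed simp
  have "\<bar>?f y - ?f x\<bar> \<le> 2 * (y - x)" if "x \<le> y" for x y
  proof -
    consider "y \<le> z" | "z \<le> x" | "x \<le> z" "z \<le> y" by linarith
    thus ?thesis
    proof cases
      case 3
      thus ?thesis using left[of x z] right[of z y] by simp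
    qed (use that left right in auto)
  qed
  from this[of x y] this[of y x] show ?thesis by (cases "x \<le> y") (simp_all add: abs_minus_commute)
qed

text \<open>
  The term \<open>x * f x\<close> of Stein's equation varies with a rate that grows only linearly in \<open>\<bar>x\<bar>\<close>;
  a second moment therefore controls it on average.
\<close>
lemma mult_stein_solution_near:
  assumes "\<bar>\<xi> - w\<bar> \<le> \<delta>"
  shows "\<bar>\<xi> * stein_solution z \<xi> - w * stein_solution z w\<bar> \<le> (2 * \<bar>w\<bar> + 5) * \<delta>"
proof -
  let ?f = "stein_solution z"
  have "\<xi> * ?f \<xi> - w * ?f w = (\<xi> - w) * ?f \<xi> + w * (?f \<xi> - ?f w)"
    by (simp add: algebra_simps)
  also have "\<bar>\<dots>\<bar> \<le> \<bar>\<xi> - w\<bar> * \<bar>?f \<xi>\<bar> + \<bar>w\<bar> * \<bar>?f \<xi> - ?f w\<bar>"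
    by (rule order_trans[OF abs_triangle_ineq]) (simp add: abs_mult)
  also have "\<dots> \<le> \<delta> * 5 + \<bar>w\<bar> * (2 * \<delta>)"
    using assms stein_solution_lipschitz[of z \<xi> w] abs_stein_solution_le[of z \<xi>]
    by (intro add_mono mult_mono mult_left_mono) auto
  finally show ?thesis by (simp add: algebra_simps)
qed

text \<open>
  The difference quotient of the solution over \<open>[x, y]\<close> is an average of \<open>f'\<close>, hence by
  Stein's equation equal to \<open>w * f w - \<Phi> z\<close> plus the fraction of \<open>[x, y]\<close> lying below \<open>z\<close>, up to
  the variation of \<open>\<xi> * f \<xi>\<close> near \<open>w\<close>. That fraction lies between \<open>of_bool (y \<le> z)\<close> and
  \<open>of_bool (x \<le> z)\<close>.
\<close>
lemma stein_solution_diff_bounds: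
  fixes w x y z \<delta> :: real
  assumes "x < y" and near: "\<And>\<xi>. x \<le> \<xi> \<Longrightarrow> \<xi> \<le> y \<Longrightarrow> \<bar>\<xi> - w\<bar> \<le> \<delta>"
  defines "q \<equiv> (stein_solution z y - stein_solution z x) / (y - x)"
  defines "g \<equiv> w * stein_solution z w - \<Phi> z"
  shows "of_bool (y \<le> z) + g - (2 * \<bar>w\<bar> + 5) * \<delta> \<le> q"
    and "q \<le> of_bool (x \<le> z) + g + (2 * \<bar>w\<bar> + 5) * \<delta>"
proof -
  let ?f = "stein_solution z" and ?e = "(2 * \<bar>w\<bar> + 5) * \<delta>"
  have left: "\<bar>(?f v - ?f u) - (v - u) * (g + 1)\<bar> \<le> (v - u) * ?e"
    if "x \<le> u" "u \<le> v" "v \<le> y" "v \<le> z" for u v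
  proof (cases "u = v")
    case False
    with that obtain \<xi> where \<xi>: "u < \<xi>" "\<xi> < v" "?f v - ?f u = (v - u) * (\<xi> * ?f \<xi> + 1 - \<Phi> z)"
      using stein_solution_diff_left[of u v z] by auto
    have "(?f v - ?f u) - (v - u) * (g + 1) = (v - u) * (\<xi> * ?f \<xi> - w * ?f w)"
      unfolding \<xi>(3) g_def by (simp add: algebra_simps)
    thus ?thesis
      using mult_stein_solution_near[OF near[of \<xi>], of z] \<xi> that
      by (simp add: abs_mult mult_left_mono)
  qed simp
  have right: "\<bar>(?f v - ?f u) - (v - u) * g\<bar> \<le> (v - u) * ?e"
    if "x \<le> u" "u \<le> v" "v \<le> y" "z \<le> u" for u v
  proof (cases "u = v")
    case False
    with that obtain \<xi> where \<xi>: "u < \<xi>" "\<xi> < v" "?f v - ?f u = (v - u) * (\<xi> * ?f \<xi> - \<Phi> z)"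
      using stein_solution_diff_right[of u v z] by auto
    have "(?f v - ?f u) - (v - u) * g = (v - u) * (\<xi> * ?f \<xi> - w * ?f w)"
      unfolding \<xi>(3) g_def by (simp add: algebra_simps)
    thus ?thesis
      using mult_stein_solution_near[OF near[of \<xi>], of z] \<xi> that
      by (simp add: abs_mult mult_left_mono)
  qed simp
  have "(y - x) * (of_bool (y \<le> z) + g - ?e) \<le> ?f y - ?f x \<and>
        ?f y - ?f x \<le> (y - x) * (of_bool (x \<le> z) + g + ?e)"
  proof -
    consider "y \<le> z" | "z < x" | "x \<le> z" "z < y" by linarith
    thus ?thesis
    proof cases
      case 1
      thus ?thesis using left[of x y] assms(1) by (auto simp: abs_le_iff algebra_simps)
    next
      case 2
      thus ?thesis using right[of x y] assms(1) by (auto simp: abs_le_iff algebra_simps)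
    next
      case 3
      have "?f y - ?f x = (?f z - ?f x) + (?f y - ?f z)" by simp
      thus ?thesis using left[of x z] right[of z y] 3 by (auto simp: abs_le_iff algebra_simps)
    qed
  qed
  thus "of_bool (y \<le> z) + g - ?e \<le> q" "q \<le> of_bool (x \<le> z) + g + ?e"
    using assms(1) by (simp_all add: q_def field_simps)
qed

section \<open>A Berry--Esseen bound for bounded integer-valued summands\<close>

abbreviation expect :: "nat pmf \<Rightarrow> (nat \<Rightarrow> real) \<Rightarrow> real"
  where "expect p f \<equiv> measure_pmf.expectation p f"

primrec iid_sum_pmf :: "nat pmf \<Rightarrow> nat \<Rightarrow> nat pmf" where
  "iid_sum_pmf p 0 = return_pmf 0"
| "iid_sum_pmf p (Suc N) = bind_pmf (iid_sum_pmf p N) (\<lambda>s. map_pmf ((+) s) p)"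

locale bounded_summand =
  fixes p :: "nat pmf" and m :: nat
  assumes set_pmf_le: "set_pmf p \<subseteq> {..m}"
begin

definition mean :: real where "mean = expect p real"

definition variance :: real where "variance = expect p (\<lambda>x. (real x - mean)\<^sup>2)"

lemma finite_set_pmf [simp]: "finite (set_pmf p)"
  using set_pmf_le finite_subset by blast

lemma finite_set_iid_sum_pmf [simp]: "finite (set_pmf (iid_sum_pmf p N))"
  by (induction N) auto

lemma integrable [simp]: "integrable (measure_pmf p) (f :: nat \<Rightarrow> real)"
  by (simp add: integrable_measure_pmf_finite)

lemma integrable_iid_sum [simp]: "integrable (measure_pmf (iid_sum_pmf p N)) (f :: nat \<Rightarrow> real)"
  by (simp add: integrable_measure_pmf_finite)

lemma expect_iid_sum_Suc:
  "expect (iid_sum_pmf p (Suc N)) f = expect (iid_sum_pmf p N) (\<lambda>s. expect p (\<lambda>x. f (s + x)))"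
proof -
  have "expect (iid_sum_pmf p (Suc N)) f =
        (\<Sum>s\<in>set_pmf (iid_sum_pmf p N). pmf (iid_sum_pmf p N) s *\<^sub>R expect (map_pmf ((+) s) p) f)"
    unfolding iid_sum_pmf.simps by (intro pmf_expectation_bind) auto
  also have "\<dots> = expect (iid_sum_pmf p N) (\<lambda>s. expect (map_pmf ((+) s) p) f)"
    by (subst integral_measure_pmf[of "set_pmf (iid_sum_pmf p N)"]) (auto simp: set_pmf_iff)
  finally show ?thesis by simp
qed

lemma expect_centered: "expect p (\<lambda>x. real x - mean) = 0"
  by (simp add: mean_def)

lemma expect_swap:
  "expect p (\<lambda>x. expect (iid_sum_pmf p N) (\<lambda>s. f s x)) =
   expect (iid_sum_pmf p N) (\<lambda>s. expect p (f s))"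
proof -
  have p: "expect p g = (\<Sum>x\<in>set_pmf p. g x * pmf p x)" for g
    by (intro integral_measure_pmf_real) auto
  have sum: "expect (iid_sum_pmf p N) g = (\<Sum>s\<in>set_pmf (iid_sum_pmf p N). g s * pmf (iid_sum_pmf p N) s)"
    for g by (intro integral_measure_pmf_real) auto
  show ?thesis
    unfolding p sum sum_distrib_right
    by (subst sum.swap) (simp only: mult.assoc mult.commute[of "pmf p _"])
qed

text \<open>
  By exchangeability every summand contributes equally to the left hand side, and the
  last one is independent of the sum of the others.
\<close>
lemma expect_centered_sum_mult:
  "expect (iid_sum_pmf p (Suc N)) (\<lambda>s. (real s - (real N + 1) * mean) * g s) =
   (real N + 1) * expect (iid_sum_pmf p N) (\<lambda>s. expect p (\<lambda>x. (real x - mean) * g (s + x)))"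
proof (induction N arbitrary: g)
  case 0
  show ?case unfolding expect_iid_sum_Suc by simp
next
  case (Suc N)
  let ?E = "\<lambda>N. expect (iid_sum_pmf p N)"
  let ?T = "?E (Suc N) (\<lambda>s. expect p (\<lambda>x. (real x - mean) * g (s + x)))"
  have "?E (Suc (Suc N)) (\<lambda>s. (real s - (real (Suc N) + 1) * mean) * g s) =
        ?E (Suc N) (\<lambda>s. expect p (\<lambda>x. (real s - (real N + 1) * mean) * g (s + x) +
                                        (real x - mean) * g (s + x)))"
    unfolding expect_iid_sum_Suc[of "Suc N"] by (simp add: algebra_simps)
  also have "\<dots> = ?E (Suc N) (\<lambda>s. expect p (\<lambda>x. (real s - (real N + 1) * mean) * g (s + x))) + ?T"
    by (simp del: iid_sum_pmf.simps)
  also have "?E (Suc N) (\<lambda>s. expect p (\<lambda>x. (real s - (real N + 1) * mean) * g (s + x))) =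
             expect p (\<lambda>x. ?E (Suc N) (\<lambda>s. (real s - (real N + 1) * mean) * g (s + x)))"
    by (rule expect_swap[symmetric])
  also have "\<dots> = expect p (\<lambda>x. (real N + 1) *
      ?E N (\<lambda>s. expect p (\<lambda>y. (real y - mean) * g (s + y + x))))"
    by (subst Suc.IH) simp
  also have "\<dots> = (real N + 1) * ?E N (\<lambda>s. expect p (\<lambda>x. expect p (\<lambda>y. (real y - mean) * g (s + y + x))))"
    by (simp add: expect_swap)
  also have "\<dots> = (real N + 1) * ?T"
    unfolding expect_iid_sum_Suc by (simp add: add_ac)
  finally show ?case by (simp add: algebra_simps)
qed

text \<open>
  This is the previous lemma for an affine \<open>g\<close>: given the sum of the other variables, only the
  variance of the separated one survives.
\<close>
lemma expect_variance_iid_sum: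
  "expect (iid_sum_pmf p N) (\<lambda>s. (real s - real N * mean)\<^sup>2) = real N * variance"
proof (cases N)
  case (Suc M)
  have *: "expect p (\<lambda>x. (real x - mean) * (real (s + x) - (real M + 1) * mean)) = variance" for s
  proof -
    have "(\<lambda>x. (real x - mean) * (real (s + x) - (real M + 1) * mean)) =
          (\<lambda>x. (real x - mean)\<^sup>2 + (real s - real M * mean) * (real x - mean))"
      by (auto simp: algebra_simps power2_eq_square)
    thus ?thesis by (simp add: variance_def expect_centered del: Bochner_Integration.integral_diff)
  qed
  have N: "real N = real M + 1" using Suc by simp
  show ?thesis
    using expect_centered_sum_mult[of M "\<lambda>s. real s - (real M + 1) * mean"]
    unfolding * power2_eq_square N unfolding Suc by simp
qed simp

text \<open>
  Divided by the variance, these weights are the probabilities of the unit intervals \<open>[j, j + 1]\<close>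
  under the zero-bias distribution of the centred summand, translated back by the mean; its density
  is constant on each of these intervals.
\<close>
definition zero_bias_weight :: "nat \<Rightarrow> real"
  where "zero_bias_weight j = expect p (\<lambda>x. (real x - mean) * of_bool (x > j))"

text \<open>
  For \<open>j \<ge> mean\<close> the integrand is nonnegative. Otherwise, since the centred variable has
  expectation 0, the event \<open>x > j\<close> may be exchanged for its complement with the opposite sign.
\<close>
lemma zero_bias_weight_nonneg: "0 \<le> zero_bias_weight j"
proof (cases "real j \<ge> mean")
  case True
  thus ?thesis unfolding zero_bias_weight_def
    by (intro Bochner_Integration.integral_nonneg) auto
next
  case False
  have "(\<lambda>x. (real x - mean) * of_bool (x > j)) =
        (\<lambda>x. (real x - mean) + (mean - real x) * of_bool (x \<le> j))"
    by auto
  hence "zero_bias_weight j = expect p (\<lambda>x. (mean - real x) * of_bool (x \<le> j))"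
    by (simp add: zero_bias_weight_def expect_centered del: Bochner_Integration.integral_diff)
  thus ?thesis using False
    by (auto intro!: Bochner_Integration.integral_nonneg)
qed

text \<open>
  Summation by parts: \<open>g\<close> is written as a sum of its increments. It is the discrete form of the
  defining identity \<open>E (X g(X)) = \<sigma>\<^sup>2 E (g'(X\<^sup>*))\<close> of the zero-bias distribution.
\<close>
lemma expect_centered_mult:
  "expect p (\<lambda>x. (real x - mean) * g x) = (\<Sum>j<m. zero_bias_weight j * (g (Suc j) - g j))"
proof -
  have g: "g x = g 0 + (\<Sum>j<m. of_bool (x > j) * (g (Suc j) - g j))" if "x \<le> m" for x
  proof -
    have "(\<Sum>j<m. of_bool (x > j) * (g (Suc j) - g j)) = (\<Sum>j<x. g (Suc j) - g j)"
      using that by (intro sum.mono_neutral_cong_right) auto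
    thus ?thesis by (simp add: sum_lessThan_telescope)
  qed
  have "expect p (\<lambda>x. (real x - mean) * g x) = expect p (\<lambda>x. g 0 * (real x - mean) +
      (\<Sum>j<m. (g (Suc j) - g j) * ((real x - mean) * of_bool (x > j))))"
  proof (intro integral_cong_AE)
    show "AE x in measure_pmf p. (real x - mean) * g x = g 0 * (real x - mean) +
      (\<Sum>j<m. (g (Suc j) - g j) * ((real x - mean) * of_bool (x > j)))"
    proof (rule AE_pmfI)
      fix x assume "x \<in> set_pmf p"
      hence "x \<le> m" using set_pmf_le by auto
      from g[OF this] have "(real x - mean) * g x =
          (real x - mean) * (g 0 + (\<Sum>j<m. of_bool (x > j) * (g (Suc j) - g j)))"
        by metis
      thus "(real x - mean) * g x = g 0 * (real x - mean) +
        (\<Sum>j<m. (g (Suc j) - g j) * ((real x - mean) * of_bool (x > j)))"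
        by (simp add: distrib_left sum_distrib_left mult_ac)
    qed
  qed auto
  also have "\<dots> = (\<Sum>j<m. zero_bias_weight j * (g (Suc j) - g j))"
    by (simp add: expect_centered zero_bias_weight_def mult.commute
             del: Bochner_Integration.integral_diff)
  finally show ?thesis .
qed

lemma sum_zero_bias_weight: "(\<Sum>j<m. zero_bias_weight j) = variance"
proof -
  have "(\<Sum>j<m. zero_bias_weight j) = expect p (\<lambda>x. (real x - mean) * (real x - mean))"
    by (simp add: expect_centered_mult)
  thus ?thesis by (simp add: variance_def power2_eq_square)
qed

definition scale :: "nat \<Rightarrow> real" where "scale N = sqrt (real N * variance)"

definition standardize :: "nat \<Rightarrow> nat \<Rightarrow> real"
  where "standardize N s = (real s - real N * mean) / scale N"

context
  fixes N :: nat and z :: real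
  assumes variance_pos: "variance > 0" and N_pos: "N > 0"
begin

private abbreviation "W \<equiv> standardize N"
private abbreviation "h \<equiv> real m / scale N"
private abbreviation "f \<equiv> stein_solution z"

lemma scale_pos: "scale N > 0"
  using variance_pos N_pos by (simp add: scale_def)

lemma expect_abs_standardize: "expect (iid_sum_pmf p N) (\<lambda>s. \<bar>W s\<bar>) \<le> 1"
proof -
  have "expect (iid_sum_pmf p N) (\<lambda>s. (W s)\<^sup>2) = 1"
    using scale_pos variance_pos N_pos
    by (simp add: standardize_def power_divide expect_variance_iid_sum scale_def)
  moreover have "\<bar>w\<bar> \<le> (1 + w\<^sup>2) / 2" for w :: real
    using zero_le_power2[of "\<bar>w\<bar> - 1"] by (simp add: power2_eq_square algebra_simps)
  hence "expect (iid_sum_pmf p N) (\<lambda>s. \<bar>W s\<bar>) \<le> expect (iid_sum_pmf p N) (\<lambda>s. (1 + (W s)\<^sup>2) / 2)"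
    by (intro integral_mono) auto
  ultimately show ?thesis by simp
qed

text \<open>
  The zero-bias identity for the standardised sum: \<open>E (W f(W))\<close> is an average of difference
  quotients of \<open>f\<close> over the lattice cells \<open>[s + j, s + j + 1]\<close>, where \<open>s\<close> is the sum of all summands
  but one and \<open>j\<close> is drawn with the zero-bias weights.
\<close>
lemma expect_standardize_mult:
  obtains M where "N = Suc M"
    "expect (iid_sum_pmf p N) (\<lambda>s. W s * f (W s)) = expect (iid_sum_pmf p M) (\<lambda>s.
       \<Sum>j<m. zero_bias_weight j / variance *
         ((f (W (s + Suc j)) - f (W (s + j))) / (W (s + Suc j) - W (s + j))))"
proof -
  obtain M where N: "N = Suc M" using N_pos by (cases N) auto
  have step: "W (s + Suc j) - W (s + j) = 1 / scale N" for s j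
    by (simp add: standardize_def field_simps flip: diff_divide_distrib)
  have sq: "real N / scale N = scale N / variance"
    using scale_pos variance_pos N_pos by (simp add: scale_def field_simps)
  have real_N: "real M + 1 = real N" using N by simp
  have W_mult: "W s * y = (real s - real N * mean) * y / scale N" for s y
    by (simp add: standardize_def)
  have "expect (iid_sum_pmf p N) (\<lambda>s. W s * f (W s)) =
        expect (iid_sum_pmf p N) (\<lambda>s. (real s - real N * mean) * f (W s)) / scale N"
    by (simp only: W_mult Bochner_Integration.integral_divide_zero)
  also have "\<dots> = real N / scale N * expect (iid_sum_pmf p M) (\<lambda>s.
      \<Sum>j<m. zero_bias_weight j * (f (W (s + Suc j)) - f (W (s + j))))"
    using expect_centered_sum_mult[of M "\<lambda>s. f (W s)"]
    unfolding N[symmetric] real_N expect_centered_mult by simp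
  also have "\<dots> = expect (iid_sum_pmf p M) (\<lambda>s. real N / scale N * (
      \<Sum>j<m. zero_bias_weight j * (f (W (s + Suc j)) - f (W (s + j)))))"
    by simp
  also have "\<dots> = expect (iid_sum_pmf p M) (\<lambda>s.
       \<Sum>j<m. zero_bias_weight j / variance *
         ((f (W (s + Suc j)) - f (W (s + j))) / (W (s + Suc j) - W (s + j))))"
    by (simp only: step sq sum_distrib_left) (simp add: field_simps)
  finally show thesis using N that by blast
qed

text \<open>
  The cell \<open>[s + j, s + j + 1]\<close> and the value \<open>s + x\<close> both lie in \<open>[s, s + m]\<close>, so that after
  standardisation they are within \<open>h\<close> of each other, whatever \<open>s\<close> is.
\<close>
lemma stein_quotient_bounds:
  fixes j s x :: nat
  assumes "j < m" "x \<le> m"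
  defines "q \<equiv> (f (W (s + Suc j)) - f (W (s + j))) / (W (s + Suc j) - W (s + j))"
  defines "w \<equiv> W (s + x)"
  shows "of_bool (w \<le> z - h) + (w * f w - \<Phi> z) - (2 * \<bar>w\<bar> + 5) * h \<le> q" (is ?lower)
    and "q \<le> of_bool (w \<le> z + h) + (w * f w - \<Phi> z) + (2 * \<bar>w\<bar> + 5) * h" (is ?upper)
proof -
  have Wdiff: "W (s + k) = w + (real k - real x) / scale N" for k
    by (simp add: w_def standardize_def flip: add_divide_distrib)
  have less: "W (s + j) < W (s + Suc j)"
    using scale_pos by (simp add: standardize_def divide_strict_right_mono)
  have le: "\<bar>W (s + k) - w\<bar> \<le> h" if "k \<le> m" for k
    using that assms(2) scale_pos by (simp add: Wdiff abs_divide divide_right_mono)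
  have le_j: "\<bar>W (s + j) - w\<bar> \<le> h" "\<bar>W (s + Suc j) - w\<bar> \<le> h"
    using assms(1) by (intro le; simp)+
  have near: "\<bar>\<xi> - w\<bar> \<le> h" if "W (s + j) \<le> \<xi>" "\<xi> \<le> W (s + Suc j)" for \<xi>
    using that le_j by linarith
  note bounds = stein_solution_diff_bounds[OF less near, of z, folded q_def]
  have "of_bool (w \<le> z - h) \<le> (of_bool (W (s + Suc j) \<le> z) :: real)"
    using le_j(2) by auto
  thus ?lower using bounds(1) by linarith
  have "of_bool (W (s + j) \<le> z) \<le> (of_bool (w \<le> z + h) :: real)"
    using le_j(1) by auto
  thus ?upper using bounds(2) by linarith
qed

text \<open>
  By the zero-bias identity and the bounds on single quotients, \<open>E (W f(W))\<close> lies, up to an error,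
  between \<open>P (W \<le> z - h) + E (W f(W)) - \<Phi> z\<close> and \<open>P (W \<le> z + h) + E (W f(W)) - \<Phi> z\<close>. The terms
  \<open>E (W f(W))\<close> cancel. The error is at most \<open>(2 * E \<bar>W\<bar> + 5) * h \<le> 7 * h\<close>.
\<close>
lemma berry_esseen_lower_upper:
  shows "measure_pmf.prob (iid_sum_pmf p N) {s. W s \<le> z - h} \<le> \<Phi> z + 7 * h" (is ?upper)
    and "\<Phi> z - 7 * h \<le> measure_pmf.prob (iid_sum_pmf p N) {s. W s \<le> z + h}" (is ?lower)
proof -
  obtain M where N: "N = Suc M" and
    stein: "expect (iid_sum_pmf p N) (\<lambda>s. W s * f (W s)) = expect (iid_sum_pmf p M) (\<lambda>s.
       \<Sum>j<m. zero_bias_weight j / variance *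
         ((f (W (s + Suc j)) - f (W (s + j))) / (W (s + Suc j) - W (s + j))))"
      (is "_ = expect _ ?D")
    by (rule expect_standardize_mult)
  let ?E = "expect (iid_sum_pmf p N)"
  let ?A = "\<lambda>t s. of_bool (W s \<le> t) + (W s * f (W s) - \<Phi> z)"
  let ?e = "\<lambda>s. (2 * \<bar>W s\<bar> + 5) * h"
  have weights: "(\<Sum>j<m. zero_bias_weight j / variance) = 1"
    using variance_pos by (simp add: sum_zero_bias_weight flip: sum_divide_distrib)
  have D: "?A (z - h) (s + x) - ?e (s + x) \<le> ?D s" "?D s \<le> ?A (z + h) (s + x) + ?e (s + x)"
    if "x \<le> m" for s x
  proof -
    have "(\<Sum>j<m. zero_bias_weight j / variance * (?A (z - h) (s + x) - ?e (s + x))) \<le> ?D s"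
      using that variance_pos
      by (intro sum_mono mult_left_mono stein_quotient_bounds(1))
         (auto intro: zero_bias_weight_nonneg divide_nonneg_pos)
    thus "?A (z - h) (s + x) - ?e (s + x) \<le> ?D s"
      by (simp only: weights flip: sum_distrib_right) simp
    have "?D s \<le> (\<Sum>j<m. zero_bias_weight j / variance * (?A (z + h) (s + x) + ?e (s + x)))"
      using that variance_pos
      by (intro sum_mono mult_left_mono stein_quotient_bounds(2))
         (auto intro: zero_bias_weight_nonneg divide_nonneg_pos)
    thus "?D s \<le> ?A (z + h) (s + x) + ?e (s + x)"
      by (simp only: weights flip: sum_distrib_right) simp
  qed
  have D': "expect p (\<lambda>x. ?A (z - h) (s + x) - ?e (s + x)) \<le> ?D s"
           "?D s \<le> expect p (\<lambda>x. ?A (z + h) (s + x) + ?e (s + x))" for s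
  proof -
    have "expect p (\<lambda>x. ?A (z - h) (s + x) - ?e (s + x)) \<le> expect p (\<lambda>_. ?D s)"
      by (intro integral_mono_AE integrable AE_pmfI D(1)) (use set_pmf_le in blast)
    thus "expect p (\<lambda>x. ?A (z - h) (s + x) - ?e (s + x)) \<le> ?D s" by simp
    have "expect p (\<lambda>_. ?D s) \<le> expect p (\<lambda>x. ?A (z + h) (s + x) + ?e (s + x))"
      by (intro integral_mono_AE integrable AE_pmfI D(2)) (use set_pmf_le in blast)
    thus "?D s \<le> expect p (\<lambda>x. ?A (z + h) (s + x) + ?e (s + x))" by simp
  qed
  have E_A: "?E (?A t) = measure_pmf.prob (iid_sum_pmf p N) {s. W s \<le> t} +
               ?E (\<lambda>s. W s * f (W s)) - \<Phi> z" for t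
  proof -
    have "?E (\<lambda>s. of_bool (W s \<le> t)) = ?E (indicator {s. W s \<le> t})"
      by (intro Bochner_Integration.integral_cong) (auto simp: indicator_def)
    thus ?thesis by simp
  qed
  have E_e: "?E ?e \<le> 7 * h"
  proof -
    have "?E ?e = (2 * ?E (\<lambda>s. \<bar>W s\<bar>) + 5) * h" by simp
    also have "\<dots> \<le> (2 * 1 + 5) * h"
      using expect_abs_standardize scale_pos by (intro mult_right_mono) auto
    finally show ?thesis by simp
  qed
  have "?E (\<lambda>s. ?A (z - h) s - ?e s) \<le> ?E (\<lambda>s. W s * f (W s))"
    unfolding stein unfolding N expect_iid_sum_Suc unfolding N[symmetric]
    by (intro integral_mono integrable_iid_sum D')
  hence "?E (?A (z - h)) - ?E ?e \<le> ?E (\<lambda>s. W s * f (W s))"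
    by (subst (asm) Bochner_Integration.integral_diff) auto
  thus ?upper using E_A[of "z - h"] E_e by linarith
  have "?E (\<lambda>s. W s * f (W s)) \<le> ?E (\<lambda>s. ?A (z + h) s + ?e s)"
    unfolding stein unfolding N expect_iid_sum_Suc unfolding N[symmetric]
    by (intro integral_mono integrable_iid_sum D')
  hence "?E (\<lambda>s. W s * f (W s)) \<le> ?E (?A (z + h)) + ?E ?e"
    by (subst (asm) Bochner_Integration.integral_add) auto
  thus ?lower using E_A[of "z + h"] E_e by linarith
qed

end

text \<open>
  Let \<open>h = m / scale N\<close>. The distance \<open>h\<close> of \<open>Y\<close> from the standardised sum and the shift by \<open>h\<close> in the
  bounds above are absorbed by applying them at \<open>z \<plusminus> 2 * h\<close>. As \<open>\<Phi>\<close> has Lipschitz constant 1,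
  this adds \<open>2 * h\<close> to the error \<open>7 * h\<close>.
\<close>
theorem kolmogorov_dist_near_iid_sum:
  fixes Q :: "'b pmf" and Y :: "'b \<Rightarrow> real"
  assumes "variance > 0" "N > 0"
    and law: "map_pmf X Q = iid_sum_pmf p N"
    and near: "\<And>\<omega>. \<omega> \<in> set_pmf Q \<Longrightarrow> \<bar>Y \<omega> - standardize N (X \<omega>)\<bar> \<le> real m / scale N"
  shows "kolmogorov_dist (distr (measure_pmf Q) borel Y) std_normal_distribution
           \<le> 9 * (real m / scale N)"
  unfolding kolmogorov_dist_def
proof (rule cSUP_least)
  fix z :: real
  define h where "h = real m / scale N"
  have h: "0 \<le> h" using assms by (simp add: h_def scale_def)
  have X_law: "measure_pmf.prob (iid_sum_pmf p N) {s. standardize N s \<le> t} =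
               measure_pmf.prob Q {\<omega>. standardize N (X \<omega>) \<le> t}" for t
    by (simp add: vimage_def flip: law)
  have cdf_Y: "cdf (distr (measure_pmf Q) borel Y) z = measure_pmf.prob Q {\<omega>. Y \<omega> \<le> z}"
    by (simp add: cdf_def measure_distr vimage_def)
  have mono: "measure_pmf.prob Q A \<le> measure_pmf.prob Q B" if "A \<inter> set_pmf Q \<subseteq> B" for A B
    using measure_pmf.finite_measure_mono[of "A \<inter> set_pmf Q" B Q] that
    by (simp add: measure_Int_set_pmf)
  have "measure_pmf.prob Q {\<omega>. Y \<omega> \<le> z} \<le> measure_pmf.prob Q {\<omega>. standardize N (X \<omega>) \<le> z + 2 * h - h}"
    using near by (intro mono) (fastforce simp: h_def abs_le_iff)
  also have "\<dots> \<le> \<Phi> (z + 2 * h) + 7 * h"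
    using berry_esseen_lower_upper(1)[OF assms(1,2), of "z + 2 * h"] by (simp add: X_law h_def)
  also have "\<Phi> (z + 2 * h) \<le> \<Phi> z + (z + 2 * h - z)"
    using h by (intro std_normal_cdf_lipschitz) simp
  finally have upper: "measure_pmf.prob Q {\<omega>. Y \<omega> \<le> z} \<le> \<Phi> z + 9 * h" by simp
  have "\<Phi> z \<le> \<Phi> (z - 2 * h) + (z - (z - 2 * h))"
    using h by (intro std_normal_cdf_lipschitz) simp
  also have "\<Phi> (z - 2 * h) \<le> measure_pmf.prob Q {\<omega>. standardize N (X \<omega>) \<le> z - 2 * h + h} + 7 * h"
    using berry_esseen_lower_upper(2)[OF assms(1,2), of "z - 2 * h"] by (simp add: X_law h_def)
  also have "measure_pmf.prob Q {\<omega>. standardize N (X \<omega>) \<le> z - 2 * h + h} \<le> measure_pmf.prob Q {\<omega>. Y \<omega> \<le> z}"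
    using near by (intro mono) (fastforce simp: h_def abs_le_iff)
  finally have lower: "\<Phi> z - 9 * h \<le> measure_pmf.prob Q {\<omega>. Y \<omega> \<le> z}" by simp
  show "\<bar>cdf (distr (measure_pmf Q) borel Y) z - cdf std_normal_distribution z\<bar>
          \<le> 9 * (real m / scale N)"
    using upper lower unfolding cdf_Y by (simp add: h_def abs_le_iff flip: std_normal_cdf_def)
qed simp

end

section \<open>Interleavings as words\<close>

definition word_des :: "nat list \<Rightarrow> nat"
  where "word_des xs = card {i. Suc i < length xs \<and> xs ! i > xs ! Suc i}"

text \<open>
  Suppose \<open>x\<close> is the least point of difference and \<open>f x < g x\<close>. Then \<open>f x = g y\<close> for some \<open>y\<close>, which
  satisfies \<open>y < x\<close>, hence \<open>f y = g y = f x\<close>, against injectivity.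
\<close>
lemma strict_mono_on_image_unique:
  fixes f g :: "nat \<Rightarrow> nat"
  assumes "strict_mono_on A f" "strict_mono_on A g" "f ` A = g ` A" "x \<in> A"
  shows "f x = g x"
  using assms(4)
proof (induction x rule: less_induct)
  case (less x)
  have no: False if *: "strict_mono_on A u" "strict_mono_on A v" "u ` A = v ` A" "u x < v x"
    "\<And>y. y < x \<Longrightarrow> y \<in> A \<Longrightarrow> u y = v y" for u v :: "nat \<Rightarrow> nat"
  proof -
    obtain y where y: "y \<in> A" "u x = v y" using less.prems *(3) by blast
    have "y < x"
      using y *(2,4) less.prems by (metis leI not_less_iff_gr_or_eq order_less_imp_not_less
          strict_mono_onD order_le_imp_less_or_eq)
    hence "u y = u x" using *(5) y by simp
    thus False using *(1) \<open>y < x\<close> y(1) less.prems by (metis less_irrefl strict_mono_onD)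
  qed
  show ?case
    using no[of f g] no[of g f] assms(1-3) less.IH by (metis linorder_neqE_nat)
qed

locale deck_cut =
  fixes n a :: nat and b :: "nat \<Rightarrow> nat"
  assumes pile_sizes: "b \<in> pile_sizes n a"
begin

lemma sum_pile_sizes: "(\<Sum>i\<in>{1..a}. b i) = n"
  using pile_sizes by (simp add: pile_sizes_def)

lemma pile_eq: "i \<ge> 1 \<Longrightarrow> pile b i = {Suc (\<Sum>j\<in>{1..<i}. b j)..(\<Sum>j\<in>{1..<i}. b j) + b i}"
  using sum.last_plus[of 1 i b] by (cases i) (simp_all add: pile_def atLeastLessThanSuc_atLeastAtMost add.commute)

lemma card_pile: "i \<ge> 1 \<Longrightarrow> card (pile b i) = b i"
  by (simp add: pile_eq)

lemma pile_less:
  assumes "i < k" "c \<in> pile b i" "d \<in> pile b k"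
  shows "c < d"
proof -
  have "c \<le> (\<Sum>j\<in>{1..i}. b j)" using assms by (simp add: pile_def)
  also have "\<dots> \<le> (\<Sum>j\<in>{1..<k}. b j)" using assms(1) by (intro sum_mono2) auto
  also have "\<dots> < d" using assms(3) by (simp add: pile_def)
  finally show ?thesis .
qed

lemma UN_pile: "(\<Union>i\<in>{1..a}. pile b i) = {1..n}"
proof -
  have "(\<Union>i\<in>{1..k}. pile b i) = {1..\<Sum>i\<in>{1..k}. b i}" for k
  proof (induction k)
    case (Suc k)
    have "(\<Union>i\<in>{1..Suc k}. pile b i) = (\<Union>i\<in>{1..k}. pile b i) \<union> pile b (Suc k)"
      by (simp add: atLeastAtMostSuc_conv Un_commute)
    also have "\<dots> = {1..\<Sum>i\<in>{1..Suc k}. b i}"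
      unfolding Suc.IH by (auto simp: pile_def atLeastLessThanSuc_atLeastAtMost)
    finally show ?case .
  qed simp
  from this[of a] show ?thesis by (simp only: sum_pile_sizes)
qed

definition pile_index :: "nat \<Rightarrow> nat"
  where "pile_index c = (THE i. i \<in> {1..a} \<and> c \<in> pile b i)"

lemma pile_index_eq:
  assumes "i \<in> {1..a}" "c \<in> pile b i"
  shows "pile_index c = i"
  unfolding pile_index_def using assms pile_less
  by (intro the_equality) (auto, metis less_irrefl linorder_neqE_nat)

lemma pile_index:
  assumes "c \<in> {1..n}"
  shows "pile_index c \<in> {1..a}" "c \<in> pile b (pile_index c)"
proof -
  from assms obtain i where "i \<in> {1..a}" "c \<in> pile b i" using UN_pile by blast
  thus "pile_index c \<in> {1..a}" "c \<in> pile b (pile_index c)" by (simp_all add: pile_index_eq)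
qed

lemma pile_eq_vimage: "i \<in> {1..a} \<Longrightarrow> pile b i = {c \<in> {1..n}. pile_index c = i}"
  using UN_pile pile_index pile_index_eq by blast

definition interleaving_word :: "(nat \<Rightarrow> nat) \<Rightarrow> nat list"
  where "interleaving_word \<rho> = map (\<lambda>k. pile_index (\<rho> k)) [1..<Suc n]"

definition pile_mset :: "nat multiset"
  where "pile_mset = (\<Sum>i\<in>{1..a}. replicate_mset (b i) i)"

lemma count_pile_mset: "count pile_mset i = (if i \<in> {1..a} then b i else 0)"
  by (simp add: pile_mset_def count_sum if_distrib cong: if_cong)

lemma size_pile_mset: "size pile_mset = n"
  using sum_pile_sizes by (simp add: pile_mset_def size_multiset_sum)

lemma count_map_upt:
  "count (mset (map f [1..<Suc n])) i = card {k \<in> {1..n}. f k = i}"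
proof -
  have "mset (map f [1..<Suc n]) = image_mset f (mset_set {1..n})"
    by (simp only: mset_map mset_upt atLeastLessThanSuc_atLeastAtMost)
  hence "count (mset (map f [1..<Suc n])) i = (\<Sum>k\<in>f -` {i} \<inter> {1..n}. count (mset_set {1..n}) k)"
    by (simp only: count_image_mset finite_set_mset_mset_set finite_atLeastAtMost)
  also have "\<dots> = (\<Sum>k\<in>f -` {i} \<inter> {1..n}. 1)"
    by (intro sum.cong) auto
  also have "\<dots> = card (f -` {i} \<inter> {1..n})" by simp
  also have "f -` {i} \<inter> {1..n} = {k \<in> {1..n}. f k = i}" by auto
  finally show ?thesis .
qed

lemma length_interleaving_word [simp]: "length (interleaving_word \<rho>) = n"
  by (simp add: interleaving_word_def del: upt_Suc)

lemma nth_interleaving_word: "k < n \<Longrightarrow> interleaving_word \<rho> ! k = pile_index (\<rho> (Suc k))"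
  by (simp add: interleaving_word_def del: upt_Suc)

lemma mset_interleaving_word:
  assumes "\<rho> permutes {1..n}"
  shows "mset (interleaving_word \<rho>) = pile_mset"
proof (rule multiset_eqI)
  fix i
  have "{k \<in> {1..n}. pile_index (\<rho> k) = i} = inv \<rho> ` {c \<in> {1..n}. pile_index c = i}"
    using permutes_in_image[OF assms] permutes_in_image[OF permutes_inv[OF assms]]
      permutes_inverses[OF assms] by (auto simp: image_iff) metis+
  hence "card {k \<in> {1..n}. pile_index (\<rho> k) = i} = card {c \<in> {1..n}. pile_index c = i}"
    by (simp add: card_image permutes_inj_on[OF permutes_inv[OF assms]])
  also have "\<dots> = count pile_mset i"
  proof (cases "i \<in> {1..a}")
    case True
    thus ?thesis using card_pile[of i] by (simp add: count_pile_mset pile_eq_vimage)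
  next
    case False
    hence "{c \<in> {1..n}. pile_index c = i} = {}" using pile_index by blast
    with False show ?thesis by (simp only: count_pile_mset) simp
  qed
  finally show "count (mset (interleaving_word \<rho>)) i = count pile_mset i"
    unfolding interleaving_word_def count_map_upt .
qed

text \<open>
  The word tells which set of positions each pile occupies, and within a pile the order of the cards
  is prescribed.
\<close>
lemma inj_on_interleaving_word: "inj_on interleaving_word (interleavings n a b)"
proof (rule inj_onI)
  fix \<rho> \<sigma>
  assume \<rho>\<sigma>: "\<rho> \<in> interleavings n a b" "\<sigma> \<in> interleavings n a b"
    and eq: "interleaving_word \<rho> = interleaving_word \<sigma>"
  hence perm: "\<rho> permutes {1..n}" "\<sigma> permutes {1..n}" by (auto simp: interleavings_def)
  have index_eq: "pile_index (\<rho> k) = pile_index (\<sigma> k)" if "k \<in> {1..n}" for k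
    using nth_interleaving_word[of "k - 1"] that by (metis eq One_nat_def Suc_diff_1
        Suc_le_lessD Suc_pred atLeastAtMost_iff diff_Suc_less le_less_trans less_Suc_eq_le not_less)
  have image: "inv \<tau> ` pile b i = {k \<in> {1..n}. pile_index (\<tau> k) = i}"
    if "\<tau> permutes {1..n}" "i \<in> {1..a}" for \<tau> i
    using permutes_in_image[OF that(1)] permutes_in_image[OF permutes_inv[OF that(1)]]
      permutes_inverses[OF that(1)] that(2) by (auto simp: image_iff pile_eq_vimage) metis+
  have "inv \<rho> c = inv \<sigma> c" for c
  proof (cases "c \<in> {1..n}")
    case True
    let ?i = "pile_index c"
    have "inv \<rho> ` pile b ?i = inv \<sigma> ` pile b ?i"
      using image[OF perm(1) pile_index(1)[OF True]] image[OF perm(2) pile_index(1)[OF True]]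
        index_eq by auto
    thus ?thesis
      using \<rho>\<sigma> pile_index[OF True]
      by (intro strict_mono_on_image_unique[of "pile b ?i"]) (auto simp: interleavings_def)
  next
    case False
    thus ?thesis using perm by (simp add: permutes_not_in[OF permutes_inv])
  qed
  hence "inv \<rho> = inv \<sigma>" by blast
  thus "\<rho> = \<sigma>" using perm by (metis permutes_inv_inv)
qed

text \<open>
  The cards of the \<open>i\<close>-th pile are placed in increasing order on the positions of the letter \<open>i\<close>;
  \<open>\<tau>\<close> maps cards to positions and is the inverse of the required arrangement.
\<close>
lemma interleaving_word_surj:
  assumes "mset xs = pile_mset"
  obtains \<rho> where "\<rho> \<in> interleavings n a b" "interleaving_word \<rho> = xs"
proof -
  define P where "P i = {k \<in> {1..n}. xs ! (k - 1) = i}" for i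
  have len: "length xs = n" using assms size_pile_mset by (metis size_mset)
  have fin: "finite (P i)" for i by (simp add: P_def)
  have "xs = map (\<lambda>k. xs ! (k - 1)) [1..<Suc n]"
    using len by (intro nth_equalityI) (auto simp del: upt_Suc)
  hence "count pile_mset i = card (P i)" for i
    unfolding P_def by (metis assms count_map_upt)
  hence card_P: "card (P i) = b i" if "i \<in> {1..a}" for i
    using that by (metis count_pile_mset)
  \<comment> \<open>the rank of \<open>c\<close> in its pile, counted from 0 as \<open>enumerate\<close> does\<close>
  define pos where "pos c = c - Suc (\<Sum>j\<in>{1..<pile_index c}. b j)" for c
  define \<tau> where "\<tau> c = (if c \<in> {1..n} then enumerate (P (pile_index c)) (pos c) else c)" for c
  have pos_less: "pos c < card (P (pile_index c))" if "c \<in> {1..n}" for c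
    using pile_index[OF that] card_P[of "pile_index c"] pile_eq[of "pile_index c"]
    by (auto simp: pos_def)
  have \<tau>_in: "\<tau> c \<in> P (pile_index c)" if "c \<in> {1..n}" for c
    using that finite_enumerate_in_set[OF fin pos_less[OF that]] by (simp add: \<tau>_def)
  have \<tau>_mono: "\<tau> c < \<tau> d" if "c \<in> {1..n}" "d \<in> {1..n}" "pile_index c = pile_index d" "c < d" for c d
  proof -
    have "pos c < pos d"
      using that pile_index[OF that(1)] pile_eq[of "pile_index c"] by (auto simp: pos_def)
    thus ?thesis
      using that pos_less[OF that(2)] finite_enumerate_mono[OF _ fin] by (simp add: \<tau>_def)
  qed
  have perm: "\<tau> permutes {1..n}"
  proof (rule inj_imp_permutes)
    show "inj_on \<tau> {1..n}"
    proof (rule inj_onI)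
      fix c d assume cd: "c \<in> {1..n}" "d \<in> {1..n}" "\<tau> c = \<tau> d"
      hence "pile_index c = pile_index d" using \<tau>_in[of c] \<tau>_in[of d] by (simp add: P_def)
      thus "c = d" using cd \<tau>_mono by (metis less_irrefl linorder_neqE_nat)
    qed
    show "\<tau> c \<in> {1..n}" if "c \<in> {1..n}" for c using \<tau>_in[OF that] by (auto simp: P_def)
  qed (auto simp: \<tau>_def)
  have "inv \<tau> \<in> interleavings n a b"
    unfolding interleavings_def
    using permutes_inv[OF perm] permutes_inv_inv[OF perm] \<tau>_mono
    by (auto simp: strict_mono_on_def pile_eq_vimage)
  moreover have "interleaving_word (inv \<tau>) = xs"
  proof (rule nth_equalityI)
    fix k assume "k < length (interleaving_word (inv \<tau>))"
    hence k: "k < n" by simp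
    hence c: "inv \<tau> (Suc k) \<in> {1..n}"
      using permutes_in_image[OF permutes_inv[OF perm], of "Suc k"] by simp
    have "\<tau> (inv \<tau> (Suc k)) = Suc k" using permutes_inverses[OF perm] by simp
    with \<tau>_in[OF c] have "xs ! k = pile_index (inv \<tau> (Suc k))" by (simp add: P_def)
    thus "interleaving_word (inv \<tau>) ! k = xs ! k" using k by (simp add: nth_interleaving_word)
  qed (simp add: len)
  ultimately show thesis by (rule that)
qed

lemma bij_betw_interleaving_word:
  "bij_betw interleaving_word (interleavings n a b) (permutations_of_multiset pile_mset)"
  unfolding bij_betw_def
proof (intro conjI inj_on_interleaving_word equalityI subsetI)
  fix xs assume "xs \<in> interleaving_word ` interleavings n a b"
  thus "xs \<in> permutations_of_multiset pile_mset"
    by (auto simp: permutations_of_multiset_def interleavings_def mset_interleaving_word)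
next
  fix xs assume "xs \<in> permutations_of_multiset pile_mset"
  hence "mset xs = pile_mset" by (simp add: permutations_of_multiset_def)
  thus "xs \<in> interleaving_word ` interleavings n a b"
    using interleaving_word_surj[of xs] by blast
qed

text \<open>
  Cards from different piles compare like their piles, and two adjacent cards from the same pile
  never form a descent.
\<close>
lemma des_eq_word_des:
  assumes "\<rho> \<in> interleavings n a b"
  shows "des n \<rho> = word_des (interleaving_word \<rho>)"
proof -
  have perm: "\<rho> permutes {1..n}" using assms by (simp add: interleavings_def)
  have *: "\<rho> (Suc k) > \<rho> (Suc (Suc k)) \<longleftrightarrow> pile_index (\<rho> (Suc k)) > pile_index (\<rho> (Suc (Suc k)))"
    if "Suc k < n" for k
  proof -
    let ?c = "\<rho> (Suc k)" and ?d = "\<rho> (Suc (Suc k))"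
    have c: "?c \<in> {1..n}" and d: "?d \<in> {1..n}"
      using that permutes_in_image[OF perm] by simp_all
    consider "pile_index ?c < pile_index ?d" | "pile_index ?c > pile_index ?d"
      | "pile_index ?c = pile_index ?d" by linarith
    thus ?thesis
    proof cases
      case 1
      thus ?thesis using pile_less pile_index(2)[OF c] pile_index(2)[OF d] by fastforce
    next
      case 2
      thus ?thesis using pile_less pile_index(2)[OF c] pile_index(2)[OF d] by fastforce
    next
      case 3
      have "strict_mono_on (pile b (pile_index ?c)) (inv \<rho>)"
        using assms pile_index(1)[OF c] by (simp add: interleavings_def)
      hence "\<not> ?d < ?c"
        using pile_index(2)[OF c] pile_index(2)[OF d] 3 permutes_inverses(2)[OF perm]
        by (metis strict_mono_onD lessI less_asym)
      thus ?thesis using 3 by simp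
    qed
  qed
  have "{i \<in> {1..n - 1}. \<rho> i > \<rho> (i + 1)} = Suc ` {k. Suc k < n \<and> \<rho> (Suc k) > \<rho> (Suc (Suc k))}"
  proof (intro equalityI subsetI)
    fix i assume "i \<in> {i \<in> {1..n - 1}. \<rho> i > \<rho> (i + 1)}"
    thus "i \<in> Suc ` {k. Suc k < n \<and> \<rho> (Suc k) > \<rho> (Suc (Suc k))}"
      by (intro image_eqI[of _ _ "i - 1"]) auto
  qed auto
  hence "des n \<rho> = card {k. Suc k < n \<and> \<rho> (Suc k) > \<rho> (Suc (Suc k))}"
    by (simp add: des_def card_image)
  also have "{k. Suc k < n \<and> \<rho> (Suc k) > \<rho> (Suc (Suc k))} =
             {i. Suc i < length (interleaving_word \<rho>) \<and>
                 interleaving_word \<rho> ! i > interleaving_word \<rho> ! Suc i}"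
    using * by (auto simp: nth_interleaving_word)
  finally show ?thesis by (simp add: word_des_def)
qed

lemma map_des_pmf_of_set_interleavings:
  "map_pmf (des n) (pmf_of_set (interleavings n a b)) =
   map_pmf word_des (pmf_of_set (permutations_of_multiset pile_mset))"
proof -
  have "map_pmf (des n) (pmf_of_set (interleavings n a b)) =
        map_pmf word_des (map_pmf interleaving_word (pmf_of_set (interleavings n a b)))"
    unfolding map_pmf_comp
    by (intro map_pmf_cong refl des_eq_word_des)
       (simp add: finite_interleavings interleavings_nonempty)
  also have "map_pmf interleaving_word (pmf_of_set (interleavings n a b)) =
             pmf_of_set (permutations_of_multiset pile_mset)"
    by (intro map_pmf_of_set_bij_betw bij_betw_interleaving_word finite_interleavings
          interleavings_nonempty)
  finally show ?thesis .
qed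

lemma real_card_permutations_pile_mset:
  "real (card (permutations_of_multiset pile_mset)) = fact n / (\<Prod>i\<in>{1..a}. fact (b i))"
proof -
  have "(\<Prod>x\<in>set_mset pile_mset. fact (count pile_mset x) :: nat) = (\<Prod>i\<in>{1..a}. fact (b i))"
    by (rule prod.mono_neutral_cong_left)
       (auto simp: count_pile_mset not_in_iff simp flip: count_greater_zero_iff split: if_splits)
  hence "card (permutations_of_multiset pile_mset) * (\<Prod>i\<in>{1..a}. fact (b i) :: nat) = fact n"
    using card_permutations_of_multiset_aux[of pile_mset] by (simp add: size_pile_mset)
  from arg_cong[OF this, of real]
  have "real (card (permutations_of_multiset pile_mset)) * (\<Prod>i\<in>{1..a}. fact (b i)) = fact n"
    by (simp only: of_nat_mult of_nat_prod of_nat_fact)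
  thus ?thesis by (simp add: field_simps)
qed

end

lemma prod_list_map_eq_prod_count:
  fixes f :: "'a \<Rightarrow> 'b :: comm_semiring_1"
  assumes "finite A" "set xs \<subseteq> A"
  shows "prod_list (map f xs) = (\<Prod>x\<in>A. f x ^ count (mset xs) x)"
  using assms(2)
proof (induction xs)
  case (Cons y ys)
  have "(\<Prod>x\<in>A. f x ^ count (mset (y # ys)) x) =
        (\<Prod>x\<in>A. (if x = y then f x else 1) * f x ^ count (mset ys) x)"
    by (intro prod.cong) auto
  thus ?case using Cons assms(1) by (simp add: prod.distrib)
qed simp

lemma pmf_replicate_pmf:
  "pmf (replicate_pmf n P) xs = (if length xs = n then prod_list (map (pmf P) xs) else 0)"
proof (induction n arbitrary: xs)
  case 0
  thus ?case by (auto simp: indicator_def)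
next
  case (Suc n)
  show ?case
  proof (cases xs)
    case Nil
    thus ?thesis by (subst pmf_eq_0_set_pmf[THEN iffD2]) (auto simp del: replicate_pmf.simps simp: set_replicate_pmf)
  next
    case (Cons y ys)
    have "replicate_pmf (Suc n) P = map_pmf (\<lambda>(x, xs). x # xs) (pair_pmf P (replicate_pmf n P))"
      by (simp add: pair_pmf_def map_bind_pmf)
    hence "pmf (replicate_pmf (Suc n) P) xs =
           pmf (map_pmf (\<lambda>(x, xs). x # xs) (pair_pmf P (replicate_pmf n P))) ((\<lambda>(x, xs). x # xs) (y, ys))"
      using Cons by simp
    also have "\<dots> = pmf P y * pmf (replicate_pmf n P) ys"
      by (subst pmf_map_inj') (auto simp: inj_def pmf_pair)
    finally show ?thesis using Cons Suc.IH by simp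
  qed
qed

lemma set_cut_pmf:
  assumes "\<And>i. i \<in> {1..a} \<Longrightarrow> p i \<ge> 0" and "(\<Sum>i\<in>{1..a}. p i) = 1"
  shows "set_pmf (cut_pmf n a p) \<subseteq> pile_sizes n a"
  using pmf_cut_pmf[OF assms] by (auto simp: set_pmf_iff cut_density_def split: if_splits)

text \<open>
  A word determines the pile sizes as its letter multiplicities, and the multinomial coefficient in
  the law of the cut is exactly the number of words with these multiplicities. It cancels, and the
  product of the letter probabilities remains.
\<close>
lemma bind_cut_pmf_words:
  assumes "set_pmf P \<subseteq> {1..a}"
  shows "bind_pmf (cut_pmf n a (pmf P)) (\<lambda>b. pmf_of_set (permutations_of_multiset (deck_cut.pile_mset a b)))
         = replicate_pmf n P"
proof (rule pmf_eqI)
  fix xs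
  have sum1: "(\<Sum>i\<in>{1..a}. pmf P i) = 1"
    using assms by (intro sum_pmf_eq_1) auto
  have cut: "pmf (cut_pmf n a (pmf P)) b = cut_density n a (pmf P) b" for b
    using sum1 by (intro pmf_cut_pmf) auto
  have fin: "finite (pile_sizes n a)"
    unfolding pile_sizes_def by (rule finite_compositions) simp
  let ?M = "deck_cut.pile_mset a"
  let ?g = "\<lambda>b. pmf (pmf_of_set (permutations_of_multiset (?M b))) xs * pmf (cut_pmf n a (pmf P)) b"
  have g: "?g b = (if mset xs = ?M b then prod_list (map (pmf P) xs) else 0)"
    if b: "b \<in> pile_sizes n a" for b
  proof (cases "mset xs = ?M b")
    case True
    interpret deck_cut n a b by standard (rule b)
    have "set xs \<subseteq> {1..a}"
    proof
      fix i assume "i \<in> set xs"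
      hence "count pile_mset i > 0" using True by (metis count_greater_zero_iff set_mset_mset)
      thus "i \<in> {1..a}" by (simp add: count_pile_mset split: if_splits)
    qed
    hence "prod_list (map (pmf P) xs) = (\<Prod>i\<in>{1..a}. pmf P i ^ b i)"
      by (subst prod_list_map_eq_prod_count[of "{1..a}"]) (auto simp: True count_pile_mset)
    moreover have "xs \<in> permutations_of_multiset pile_mset"
      using True by (simp add: permutations_of_multiset_def)
    hence "pmf (pmf_of_set (permutations_of_multiset pile_mset)) xs =
           (\<Prod>i\<in>{1..a}. fact (b i)) / fact n"
      by (subst pmf_of_set) (auto simp: real_card_permutations_pile_mset)
    moreover have "pmf (cut_pmf n a (pmf P)) b =
        fact n / (\<Prod>i\<in>{1..a}. fact (b i)) * (\<Prod>i\<in>{1..a}. pmf P i ^ b i)"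
      using b by (simp add: cut cut_density_def)
    moreover have "(\<Prod>i\<in>{1..a}. fact (b i) :: real) \<noteq> 0" by simp
    ultimately show ?thesis using True by (simp only: if_True) simp
  next
    case False
    moreover from this have "xs \<notin> permutations_of_multiset (?M b)"
      by (simp add: permutations_of_multiset_def)
    ultimately show ?thesis by simp
  qed
  have "pmf (bind_pmf (cut_pmf n a (pmf P)) (\<lambda>b. pmf_of_set (permutations_of_multiset (?M b)))) xs
        = (\<Sum>b\<in>pile_sizes n a. ?g b)"
    unfolding pmf_bind using set_cut_pmf[of a "pmf P" n] sum1
    by (intro integral_measure_pmf_real fin) auto
  also have "\<dots> = (\<Sum>b\<in>pile_sizes n a. if mset xs = ?M b then prod_list (map (pmf P) xs) else 0)"
    by (intro sum.cong refl g)
  also have "\<dots> = pmf (replicate_pmf n P) xs"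
  proof (cases "length xs = n \<and> set xs \<subseteq> {1..a}")
    case True
    define b0 where "b0 = (\<lambda>i\<in>{1..a}. count (mset xs) i)"
    have "b0 \<in> pile_sizes n a"
    proof -
      have "(\<Sum>i\<in>{1..a}. b0 i) = (\<Sum>i\<in>{1..a}. count (mset xs) i)"
        by (intro sum.cong) (auto simp: b0_def)
      also have "\<dots> = (\<Sum>i\<in>set xs. count (mset xs) i)"
        using True by (intro sum.mono_neutral_right) (auto simp: count_eq_zero_iff)
      also have "\<dots> = n" using True by (simp add: size_multiset_overloaded_eq flip: size_mset)
      finally show ?thesis by (simp add: pile_sizes_def b0_def)
    qed
    moreover have "mset xs = ?M b \<longleftrightarrow> b = b0" if b: "b \<in> pile_sizes n a" for b
    proof -
      interpret deck_cut n a b by standard (rule b)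
      have "mset xs = pile_mset \<longleftrightarrow> (\<forall>i\<in>{1..a}. count (mset xs) i = b i)"
        using True by (auto simp: multiset_eq_iff count_pile_mset count_eq_zero_iff subset_iff)
      also have "\<dots> \<longleftrightarrow> b = b0"
        using b by (auto simp: b0_def pile_sizes_def PiE_iff extensional_def fun_eq_iff)
      finally show ?thesis .
    qed
    ultimately have "(\<Sum>b\<in>pile_sizes n a. if mset xs = ?M b then prod_list (map (pmf P) xs) else 0)
        = (\<Sum>b\<in>pile_sizes n a. if b = b0 then prod_list (map (pmf P) xs) else 0)"
      by (intro sum.cong) auto
    thus ?thesis using \<open>b0 \<in> pile_sizes n a\<close> fin True by (simp add: pmf_replicate_pmf)
  next
    case False
    have "mset xs \<noteq> ?M b" if b: "b \<in> pile_sizes n a" for b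
    proof
      interpret deck_cut n a b by standard (rule b)
      assume eq: "mset xs = ?M b"
      hence "length xs = n" using size_pile_mset by (metis size_mset)
      moreover have "set xs \<subseteq> {1..a}"
      proof
        fix i assume "i \<in> set xs"
        hence "count pile_mset i > 0" using eq by (metis count_greater_zero_iff set_mset_mset)
        thus "i \<in> {1..a}" by (simp add: count_pile_mset split: if_splits)
      qed
      ultimately show False using False by blast
    qed
    moreover have "xs \<notin> set_pmf (replicate_pmf n P)"
      using False assms by (auto simp: set_replicate_pmf)
    ultimately show ?thesis by (simp add: set_pmf_iff)
  qed
  finally show "pmf (bind_pmf (cut_pmf n a (pmf P))
      (\<lambda>b. pmf_of_set (permutations_of_multiset (?M b)))) xs = pmf (replicate_pmf n P) xs" .
qed

text \<open>
  Given the cut, a uniform interleaving becomes a uniform word with prescribed letter multiplicities,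
  and the random multiplicities of the cut make the letters independent.
\<close>
theorem des_riffle_pmf:
  assumes "set_pmf P \<subseteq> {1..a}"
  shows "map_pmf (des n) (riffle_pmf n a (pmf P)) = map_pmf word_des (replicate_pmf n P)"
proof -
  have sum1: "(\<Sum>i\<in>{1..a}. pmf P i) = 1"
    using assms by (intro sum_pmf_eq_1) auto
  have "map_pmf (des n) (riffle_pmf n a (pmf P)) =
        bind_pmf (cut_pmf n a (pmf P)) (\<lambda>b. map_pmf (des n) (pmf_of_set (interleavings n a b)))"
    by (simp add: riffle_pmf_def map_bind_pmf)
  also have "\<dots> = bind_pmf (cut_pmf n a (pmf P))
      (\<lambda>b. map_pmf word_des (pmf_of_set (permutations_of_multiset (deck_cut.pile_mset a b))))"
    using set_cut_pmf[of a "pmf P" n] sum1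
    by (intro bind_pmf_cong refl deck_cut.map_des_pmf_of_set_interleavings) (auto simp: deck_cut_def)
  also have "\<dots> = map_pmf word_des (replicate_pmf n P)"
    by (simp add: bind_cut_pmf_words[OF assms] flip: map_bind_pmf)
  finally show ?thesis .
qed

section \<open>Descents and cyclic differences\<close>

text \<open>
  The representative in \<open>{..<a}\<close> of \<open>y - x\<close> modulo \<open>a\<close>, for \<open>x, y \<in> {1..a}\<close>.
\<close>
definition cyclic_diff :: "nat \<Rightarrow> nat \<Rightarrow> nat \<Rightarrow> nat"
  where "cyclic_diff a x y = (if x \<le> y then y - x else y + a - x)"

fun cyclic_variation :: "nat \<Rightarrow> nat list \<Rightarrow> nat" where
  "cyclic_variation a (x # y # ys) = cyclic_diff a x y + cyclic_variation a (y # ys)"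
| "cyclic_variation a _ = 0"

lemma word_des_Cons_Cons: "word_des (x # y # ys) = of_bool (x > y) + word_des (y # ys)"
proof -
  let ?D = "\<lambda>xs. {i. Suc i < length xs \<and> xs ! i > xs ! Suc i}"
  have fin: "finite (?D xs)" for xs :: "nat list"
    by (rule finite_subset[of _ "{..<length xs}"]) auto
  have "?D (x # y # ys) = (if x > y then {0} else {}) \<union> Suc ` ?D (y # ys)"
  proof (rule set_eqI)
    fix i show "i \<in> ?D (x # y # ys) \<longleftrightarrow> i \<in> (if x > y then {0} else {}) \<union> Suc ` ?D (y # ys)"
      by (cases i) auto
  qed
  moreover have "card ((if x > y then {0} else {}) \<union> Suc ` ?D (y # ys)) =
                 of_bool (x > y) + card (Suc ` ?D (y # ys))"
    using fin by (subst card_Un_disjoint) auto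
  ultimately show ?thesis by (simp add: word_des_def card_image)
qed

text \<open>
  A cyclic difference exceeds the ordinary one by \<open>a\<close> at each descent; ordinary differences
  telescope.
\<close>
lemma cyclic_variation_eq:
  assumes "xs \<noteq> []" "set xs \<subseteq> {1..a}"
  shows "cyclic_variation a xs + hd xs = a * word_des xs + last xs"
  using assms
proof (induction a xs rule: cyclic_variation.induct)
  case (1 a x y ys)
  thus ?case by (auto simp: word_des_Cons_Cons cyclic_diff_def algebra_simps)
qed (auto simp: word_des_def)

lemma bij_betw_cyclic_diff:
  assumes "x \<in> {1..a}"
  shows "bij_betw (cyclic_diff a x) {1..a} {..<a}"
proof (rule bij_betwI[where g = "\<lambda>d. if x + d \<le> a then x + d else x + d - a"])
  show "cyclic_diff a x \<in> {1..a} \<rightarrow> {..<a}"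
    using assms by (auto simp: cyclic_diff_def)
  show "(\<lambda>d. if x + d \<le> a then x + d else x + d - a) \<in> {..<a} \<rightarrow> {1..a}"
    using assms by auto
qed (use assms in \<open>auto simp: cyclic_diff_def split: if_splits\<close>)

lemma iid_sum_pmf_Suc':
  "iid_sum_pmf p (Suc N) = bind_pmf p (\<lambda>x. map_pmf ((+) x) (iid_sum_pmf p N))"
  unfolding iid_sum_pmf.simps map_pmf_def
  by (subst bind_commute_pmf) (simp add: add.commute)

text \<open>
  Whatever the preceding letter is, the cyclic difference to a uniform letter is uniform. Hence the
  successive cyclic differences are independent, and independent of the first letter.
\<close>
lemma cyclic_variation_Cons_law:
  assumes "x \<in> {1..a}"
  shows "map_pmf (\<lambda>xs. cyclic_variation a (x # xs)) (replicate_pmf N (pmf_of_set {1..a})) =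
         iid_sum_pmf (pmf_of_set {..<a}) N"
  using assms
proof (induction N arbitrary: x)
  case (Suc N)
  let ?U = "pmf_of_set {1..a}" and ?V = "pmf_of_set {..<a}"
  have set_U: "set_pmf ?U = {1..a}" using Suc.prems by (intro set_pmf_of_set) auto
  have "map_pmf (\<lambda>xs. cyclic_variation a (x # xs)) (replicate_pmf (Suc N) ?U) =
        bind_pmf ?U (\<lambda>y. map_pmf ((+) (cyclic_diff a x y))
          (map_pmf (\<lambda>xs. cyclic_variation a (y # xs)) (replicate_pmf N ?U)))"
    by (simp add: map_bind_pmf map_pmf_comp flip: map_pmf_def)
  also have "\<dots> = bind_pmf ?U (\<lambda>y. map_pmf ((+) (cyclic_diff a x y)) (iid_sum_pmf ?V N))"
    using Suc.IH set_U by (intro bind_pmf_cong) auto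
  also have "\<dots> = bind_pmf (map_pmf (cyclic_diff a x) ?U) (\<lambda>d. map_pmf ((+) d) (iid_sum_pmf ?V N))"
    by (simp add: bind_map_pmf)
  also have "map_pmf (cyclic_diff a x) ?U = ?V"
    using Suc.prems by (intro map_pmf_of_set_bij_betw bij_betw_cyclic_diff) auto
  finally show ?case unfolding iid_sum_pmf_Suc' .
qed simp

lemma cyclic_variation_law:
  assumes "a \<ge> 1"
  shows "map_pmf (cyclic_variation a) (replicate_pmf (Suc N) (pmf_of_set {1..a})) =
         iid_sum_pmf (pmf_of_set {..<a}) N"
proof -
  let ?U = "pmf_of_set {1..a}"
  have "set_pmf ?U = {1..a}" using assms by (intro set_pmf_of_set) auto
  hence "bind_pmf ?U (\<lambda>x. map_pmf (\<lambda>xs. cyclic_variation a (x # xs)) (replicate_pmf N ?U)) =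
         bind_pmf ?U (\<lambda>_. iid_sum_pmf (pmf_of_set {..<a}) N)"
    by (intro bind_pmf_cong refl cyclic_variation_Cons_law) simp
  thus ?thesis
    by (simp add: map_pmf_def bind_assoc_pmf bind_return_pmf)
qed

lemma sum_lessThan_diff_square:
  "(\<Sum>x<a. (real x - c)\<^sup>2) =
     real a * (real a - 1) * (2 * real a - 1) / 6 - c * real a * (real a - 1) + real a * c\<^sup>2"
  by (induction a) (simp_all add: field_simps power2_eq_square)

text \<open>
  The standardised descent number and the standardised sum of the \<open>n - 1\<close> cyclic differences differ
  by \<open>(last xs - hd xs) / scale N\<close> up to sign, where both letters lie in \<open>{1..a}\<close>.
\<close>
theorem kolmogorov_dist_des_riffle:
  assumes "a \<ge> 2" "n \<ge> 2"
  shows "kolmogorov_dist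
      (distr (measure_pmf (unbiased_riffle_pmf n a)) borel
        (\<lambda>\<rho>. (real (des n \<rho>) - (real a - 1) * (real n - 1) / (2 * real a))
             / sqrt (((real a)\<^sup>2 - 1) * (real n - 1) / (12 * (real a)\<^sup>2))))
      std_normal_distribution
    \<le> 9 * ((real a - 1) / sqrt ((real n - 1) * (((real a)\<^sup>2 - 1) / 12)))"
proof -
  let ?U = "pmf_of_set {1..a}" and ?V = "pmf_of_set {..<a}"
  define N where "N = n - 1"
  have n: "n = Suc N" "N > 0" "real n - 1 = real N" using assms(2) by (auto simp: N_def)
  define T where "T d = (d - (real a - 1) * (real n - 1) / (2 * real a))
             / sqrt (((real a)\<^sup>2 - 1) * (real n - 1) / (12 * (real a)\<^sup>2))" for d
  have set_U: "set_pmf ?U = {1..a}" and set_V: "set_pmf ?V = {..<a}"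
    using assms by (intro set_pmf_of_set; force simp: lessThan_empty_iff)+
  interpret bounded_summand ?V "a - 1"
  proof
    show "set_pmf ?V \<subseteq> {..a - 1}" unfolding set_V by auto
  qed
  have mean: "mean = (real a - 1) / 2"
  proof -
    have "mean = (\<Sum>x<a. real x) / real a"
      unfolding mean_def using assms by (subst integral_pmf_of_set) (auto simp: lessThan_empty_iff)
    also have "(\<Sum>x<a. real x) = real a * (real a - 1) / 2"
      by (induction a) (simp_all add: field_simps)
    finally show ?thesis using assms by simp
  qed
  have var: "variance = ((real a)\<^sup>2 - 1) / 12"
  proof -
    have "variance = (\<Sum>x<a. (real x - (real a - 1) / 2)\<^sup>2) / real a"
      unfolding variance_def mean
      using assms by (subst integral_pmf_of_set) (auto simp: lessThan_empty_iff)
    also have "\<dots> = ((real a)\<^sup>2 - 1) / 12"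
      unfolding sum_lessThan_diff_square using assms by (simp add: field_simps power2_eq_square)
    finally show ?thesis .
  qed
  have "(real a)\<^sup>2 > 1" using assms by (simp add: one_less_power)
  hence var_pos: "variance > 0" by (simp add: var)
  have scale_pos: "scale N > 0" using var_pos n by (simp add: scale_def)
  \<comment> \<open>The normalisation by \<open>n - 1\<close> is exactly that of a sum of \<open>n - 1\<close> terms, divided by \<open>a\<close>.\<close>
  have T_scale: "T d = (real a * d - real N * mean) / scale N" for d
  proof -
    have "sqrt (((real a)\<^sup>2 - 1) * (real n - 1) / (12 * (real a)\<^sup>2)) = scale N / real a"
      by (simp add: n(3) scale_def var real_sqrt_divide real_sqrt_mult mult.commute)
    thus ?thesis using assms scale_pos by (simp add: T_def n(3) mean field_simps)
  qed

  have "pmf ?U x = 1 / real a" if "x \<in> {1..a}" for x using that by simp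
  hence "(\<Prod>i\<in>{1..a}. (1 / real a) ^ b i) = (\<Prod>i\<in>{1..a}. pmf ?U i ^ b i)" for b
    by (intro prod.cong) auto
  hence "unbiased_riffle_pmf n a = riffle_pmf n a (pmf ?U)"
    by (simp only: unbiased_riffle_pmf_def riffle_pmf_def cut_pmf_def cut_density_def[abs_def])
  hence des_law: "map_pmf (des n) (unbiased_riffle_pmf n a) = map_pmf word_des (replicate_pmf n ?U)"
    using des_riffle_pmf[of ?U a n] set_U by simp
  have "distr (measure_pmf (unbiased_riffle_pmf n a)) borel (\<lambda>\<rho>. T (real (des n \<rho>))) =
        distr (measure_pmf (map_pmf (des n) (unbiased_riffle_pmf n a))) borel (\<lambda>d. T (real d))"
    by (simp add: map_pmf_rep_eq distr_distr o_def)
  also have "\<dots> = distr (measure_pmf (replicate_pmf n ?U)) borel (\<lambda>xs. T (real (word_des xs)))"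
    unfolding des_law by (simp add: map_pmf_rep_eq distr_distr o_def)
  finally have law: "distr (measure_pmf (unbiased_riffle_pmf n a)) borel (\<lambda>\<rho>. T (real (des n \<rho>))) =
    distr (measure_pmf (replicate_pmf n ?U)) borel (\<lambda>xs. T (real (word_des xs)))" .

  have near: "\<bar>T (real (word_des xs)) - standardize N (cyclic_variation a xs)\<bar> \<le> real (a - 1) / scale N"
    if "xs \<in> set_pmf (replicate_pmf n ?U)" for xs
  proof -
    have xs: "set xs \<subseteq> {1..a}" "xs \<noteq> []"
      using that set_U n by (auto simp: set_replicate_pmf simp del: replicate_pmf.simps)
    have "real (cyclic_variation a xs) + real (hd xs) = real a * real (word_des xs) + real (last xs)"
      using arg_cong[OF cyclic_variation_eq[OF xs(2,1)], of real] by simp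
    moreover have "hd xs \<in> {1..a}" "last xs \<in> {1..a}"
      using xs hd_in_set[OF xs(2)] last_in_set[OF xs(2)] by blast+
    ultimately have "\<bar>real a * real (word_des xs) - real (cyclic_variation a xs)\<bar> \<le> real (a - 1)"
      by (auto simp: abs_le_iff of_nat_diff)
    moreover have "T (real (word_des xs)) - standardize N (cyclic_variation a xs) =
        (real a * real (word_des xs) - real (cyclic_variation a xs)) / scale N"
      by (simp add: T_scale standardize_def flip: diff_divide_distrib)
    ultimately show ?thesis
      using scale_pos by (simp add: abs_divide divide_right_mono)
  qed
  have "map_pmf (cyclic_variation a) (replicate_pmf n ?U) = iid_sum_pmf ?V N"
    unfolding n(1) using assms by (intro cyclic_variation_law) simp
  hence "kolmogorov_dist (distr (measure_pmf (replicate_pmf n ?U)) borel (\<lambda>xs. T (real (word_des xs))))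
      std_normal_distribution \<le> 9 * (real (a - 1) / scale N)"
    by (rule kolmogorov_dist_near_iid_sum[OF var_pos n(2) _ near])
  thus ?thesis
    unfolding law[symmetric] unfolding T_def scale_def var
    using assms by (simp add: n(3) of_nat_diff)
qed

theorem theorem3p6:
  fixes a :: nat
  assumes "a \<ge> 2"
  shows "\<exists>C::real. \<forall>n::nat. n \<ge> 2 \<longrightarrow>
    kolmogorov_dist
      (distr (measure_pmf (unbiased_riffle_pmf n a)) borel
        (\<lambda>\<rho>. (real (des n \<rho>) - (real a - 1) * (real n - 1) / (2 * real a))
             / sqrt (((real a)\<^sup>2 - 1) * (real n - 1) / (12 * (real a)\<^sup>2))))
      std_normal_distribution
    \<le> C / sqrt (real n)"
proof (intro exI allI impI)
  fix n :: nat
  assume n: "n \<ge> 2"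
  let ?v = "((real a)\<^sup>2 - 1) / 12"
  have v: "?v > 0" using assms by (simp add: one_less_power)
  \<comment> \<open>\<open>n - 1 \<ge> n / 2\<close>, which costs a factor \<open>sqrt 2\<close> in the constant.\<close>
  have "real n / 2 * ?v \<le> (real n - 1) * ?v"
    using n v by (intro mult_right_mono) auto
  hence "9 * ((real a - 1) / sqrt ((real n - 1) * ?v)) \<le> 9 * ((real a - 1) / sqrt (real n / 2 * ?v))"
    using assms n v by (intro mult_left_mono divide_left_mono) auto
  also have "\<dots> = 9 * (real a - 1) / sqrt (?v / 2) / sqrt (real n)"
  proof -
    have sqrt_eq: "sqrt (real n / 2 * v) = sqrt (v / 2) * sqrt (real n)" for v
      by (simp add: mult.commute flip: real_sqrt_mult)
    show ?thesis unfolding sqrt_eq[of ?v] by simp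
  qed
  finally show "kolmogorov_dist
      (distr (measure_pmf (unbiased_riffle_pmf n a)) borel
        (\<lambda>\<rho>. (real (des n \<rho>) - (real a - 1) * (real n - 1) / (2 * real a))
             / sqrt (((real a)\<^sup>2 - 1) * (real n - 1) / (12 * (real a)\<^sup>2))))
      std_normal_distribution
    \<le> 9 * (real a - 1) / sqrt (?v / 2) / sqrt (real n)"
    using kolmogorov_dist_des_riffle[OF assms n] by (rule order_trans[rotated])
qed

end
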